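(* Let $d\ge 1$ and let $T$ be a $1$-dimensional metric current in $\mathbb{R}^d$ (with the Euclidean distance). Let $\tilde T$ be the classical $1$-current induced by $T$, i.e. $\langle \tilde T,\omega\rangle=\sum_{i=1}^d T(\omega_i,x_i)$ for every smooth compactly supported $1$-form $\omega=\sum_{i=1}^d\omega_i\,dx_i$. Then $\tilde T$ is a flat chain.
   Context: Metric currents: $\mathscr{D}^k(\mathbb{R}^d):=\mathrm{Lip}_b(\mathbb{R}^d)\times\mathrm{Lip}(\mathbb{R}^d)^k$, where $\mathrm{Lip}$ denotes real-valued Lipschitz functions and $\mathrm{Lip}_b$ the bounded ones. A $k$-dimensional metric current is a multilinear functional $T:\mathscr{D}^k\to\mathbb{R}$ such that: (i) (continuity) for every $f\in\mathrm{Lip}_b$ and sequences $\pi_i^n\to\pi_i$ pointwise ($i=1,\dots,k$) with $\mathrm{Lip}(\pi_i^n)\le C$ uniformly, $T(f,\pi_1^n,\dots,\pi_k^n)\to T(f,\pi_1,\dots,\pi_k)$; (ii) (locality) if some $\pi_i$ is constant on a neighbourhood of $\mathrm{supp} f$ then $T(f,\pi_1,\dots,\pi_k)=0$; (iii) (finite mass) there is a finite Radon measure $\mu$ with $|T(f,\pi_1,\dots,\pi_k)|\le \mathrm{Lip}(\pi_1)\cdots\mathrm{Lip}(\pi_k)\int|f|\,d\mu$. Here $x_i$ denotes the $i$-th coordinate function. Classical currents: a $k$-current is a continuous linear functional on smooth compactly supported $k$-forms; its mass $\mathbb{M}(T)$ is the supremum of $\langle T,\omega\rangle$ over forms with comass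 $\|\omega\|\le 1$; $\partial T$ is defined by $\langle\partial T,\omega\rangle=\langle T,d\omega\rangle$; $T$ is normal if $\mathbb{M}(T)+\mathbb{M}(\partial T)<\infty$. The flat norm of a current is $\mathbb{F}(T)=\sup\{\langle T,\omega\rangle:\max(\|\omega\|,\|d\omega\|)\le 1\}$ (sup norms of comass), which equals $\min\{\mathbb{M}(R)+\mathbb{M}(S):T=R+\partial S\}$. A (Federer–Fleming) flat chain is a current which is a limit in the flat norm $\mathbb{F}$ of normal currents. *)

theory Defs
  imports "HOL-Analysis.Analysis" "HOL-Probability.Probability"
begin

definition lipf :: "(real^'n \<Rightarrow> real) \<Rightarrow> bool" where
  "lipf f \<longleftrightarrow> (\<exists>C. C-lipschitz_on UNIV f)"

definition lipb :: "(real^'n \<Rightarrow> real) \<Rightarrow> bool" where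
  "lipb f \<longleftrightarrow> bounded (range f) \<and> lipf f"

definition lip_const :: "(real^'n \<Rightarrow> real) \<Rightarrow> real" where
  "lip_const f = Inf {C. C-lipschitz_on UNIV f}"

definition msupp :: "(real^'n \<Rightarrow> real) \<Rightarrow> (real^'n) set" where
  "msupp f = closure {x. f x \<noteq> 0}"

definition metric_current1 :: "((real^'n \<Rightarrow> real) \<Rightarrow> (real^'n \<Rightarrow> real) \<Rightarrow> real) \<Rightarrow> bool" where
  "metric_current1 T \<longleftrightarrow>
     \<comment> \<open>multilinearity\<close>
     (\<forall>f g \<pi> a b. lipb f \<and> lipb g \<and> lipf \<pi> \<longrightarrow>
        T (\<lambda>x. a * f x + b * g x) \<pi> = a * T f \<pi> + b * T g \<pi>) \<and>
     (\<forall>f \<pi> \<sigma> a b. lipb f \<and> lipf \<pi> \<and> lipf \<sigma> \<longrightarrow>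
        T f (\<lambda>x. a * \<pi> x + b * \<sigma> x) = a * T f \<pi> + b * T f \<sigma>) \<and>
     \<comment> \<open>(i) continuity\<close>
     (\<forall>f \<pi> \<pi>s C. lipb f \<and> (\<forall>n. C-lipschitz_on UNIV (\<pi>s n)) \<and>
        (\<forall>x. (\<lambda>n. \<pi>s n x) \<longlonglongrightarrow> \<pi> x) \<longrightarrow>
        (\<lambda>n. T f (\<pi>s n)) \<longlonglongrightarrow> T f \<pi>) \<and>
     \<comment> \<open>(ii) locality\<close>
     (\<forall>f \<pi>. lipb f \<and> lipf \<pi> \<and>
        (\<exists>U c. open U \<and> msupp f \<subseteq> U \<and> (\<forall>x\<in>U. \<pi> x = c)) \<longrightarrow> T f \<pi> = 0) \<and>
     \<comment> \<open>(iii) finite mass (finite Borel measures on R^d are Radon)\<close>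
     (\<exists>\<mu> :: (real^'n) measure. finite_measure \<mu> \<and> sets \<mu> = sets borel \<and>
        (\<forall>f \<pi>. lipb f \<and> lipf \<pi> \<longrightarrow>
           \<bar>T f \<pi>\<bar> \<le> lip_const \<pi> * integral\<^sup>L \<mu> (\<lambda>x. \<bar>f x\<bar>)))"

definition pd :: "'n \<Rightarrow> (real^'n \<Rightarrow> real) \<Rightarrow> real^'n \<Rightarrow> real" where
  "pd i g x = deriv (\<lambda>t. g (x + t *\<^sub>R axis i 1)) 0"

fun pdl :: "'n list \<Rightarrow> (real^'n \<Rightarrow> real) \<Rightarrow> real^'n \<Rightarrow> real" where
  "pdl [] g = g"
| "pdl (i # is) g = pd i (pdl is g)"

definition smooth_fun :: "(real^'n \<Rightarrow> real) \<Rightarrow> bool" where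
  "smooth_fun g \<longleftrightarrow> (\<forall>\<alpha>. continuous_on UNIV (pdl \<alpha> g) \<and>
     (\<forall>i x. (\<lambda>t. pdl \<alpha> g (x + t *\<^sub>R axis i 1)) field_differentiable (at 0)))"

definition test0 :: "(real^'n \<Rightarrow> real) \<Rightarrow> bool" where
  "test0 \<phi> \<longleftrightarrow> smooth_fun \<phi> \<and> compact (closure {x. \<phi> x \<noteq> 0})"

text \<open>A 1-form \<omega> = \<Sum> \<omega>_i dx_i is represented by x \<mapsto> (\<omega>_1 x, ..., \<omega>_d x).\<close>
definition test1 :: "(real^'n \<Rightarrow> real^'n) \<Rightarrow> bool" where
  "test1 \<omega> \<longleftrightarrow> (\<forall>j. test0 (\<lambda>x. \<omega> x $ j))"

definition D_conv :: "(nat \<Rightarrow> real^'n \<Rightarrow> real^'n) \<Rightarrow> (real^'n \<Rightarrow> real^'n) \<Rightarrow> bool" where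
  "D_conv \<omega>s \<omega> \<longleftrightarrow>
     (\<exists>K. compact K \<and> (\<forall>x. x \<notin> K \<longrightarrow> \<omega> x = 0 \<and> (\<forall>k. \<omega>s k x = 0))) \<and>
     (\<forall>\<alpha> j. uniform_limit UNIV (\<lambda>k. pdl \<alpha> (\<lambda>y. \<omega>s k y $ j)) (pdl \<alpha> (\<lambda>y. \<omega> y $ j)) sequentially)"

definition current1 :: "((real^'n \<Rightarrow> real^'n) \<Rightarrow> real) \<Rightarrow> bool" where
  "current1 S \<longleftrightarrow>
     (\<forall>\<omega> \<eta> a b. test1 \<omega> \<and> test1 \<eta> \<longrightarrow>
        S (\<lambda>x. a *\<^sub>R \<omega> x + b *\<^sub>R \<eta> x) = a * S \<omega> + b * S \<eta>) \<and>
     (\<forall>\<omega>s \<omega>. (\<forall>k. test1 (\<omega>s k)) \<and> test1 \<omega> \<and> D_conv \<omega>s \<omega> \<longrightarrow>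
        (\<lambda>k. S (\<omega>s k)) \<longlonglongrightarrow> S \<omega>)"

definition dform :: "(real^'n \<Rightarrow> real^'n) \<Rightarrow> real^'n \<Rightarrow> real^'n \<Rightarrow> real^'n \<Rightarrow> real" where
  "dform \<omega> x v w = (\<Sum>i\<in>UNIV. \<Sum>j\<in>UNIV. pd i (\<lambda>y. \<omega> y $ j) x * (v $ i * w $ j - v $ j * w $ i))"

definition dfun :: "(real^'n \<Rightarrow> real) \<Rightarrow> real^'n \<Rightarrow> real^'n" where
  "dfun \<phi> x = (\<chi> i. pd i \<phi> x)"

text \<open>Comass of a 1-covector is its Euclidean norm; comass of a 2-covector is the sup
  over simple unit 2-vectors v \<and> w (v, w orthonormal).\<close>
definition comass2 :: "(real^'n \<Rightarrow> real^'n \<Rightarrow> real) \<Rightarrow> real" where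
  "comass2 \<alpha> = Sup (insert 0 {\<alpha> v w | v w. norm v = 1 \<and> norm w = 1 \<and> inner v w = 0})"

definition mass1 :: "((real^'n \<Rightarrow> real^'n) \<Rightarrow> real) \<Rightarrow> ereal" where
  "mass1 S = (SUP \<omega>\<in>{\<omega>. test1 \<omega> \<and> (\<forall>x. norm (\<omega> x) \<le> 1)}. ereal (S \<omega>))"

definition bdry_mass1 :: "((real^'n \<Rightarrow> real^'n) \<Rightarrow> real) \<Rightarrow> ereal" where
  "bdry_mass1 S = (SUP \<phi>\<in>{\<phi>. test0 \<phi> \<and> (\<forall>x. \<bar>\<phi> x\<bar> \<le> 1)}. ereal (S (dfun \<phi>)))"

definition flat_norm1 :: "((real^'n \<Rightarrow> real^'n) \<Rightarrow> real) \<Rightarrow> ereal" where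
  "flat_norm1 S = (SUP \<omega>\<in>{\<omega>. test1 \<omega> \<and> (\<forall>x. norm (\<omega> x) \<le> 1) \<and>
        (\<forall>x. comass2 (dform \<omega> x) \<le> 1)}. ereal (S \<omega>))"

definition normal1 :: "((real^'n \<Rightarrow> real^'n) \<Rightarrow> real) \<Rightarrow> bool" where
  "normal1 S \<longleftrightarrow> current1 S \<and> mass1 S < \<infinity> \<and> bdry_mass1 S < \<infinity>"

definition flat_chain1 :: "((real^'n \<Rightarrow> real^'n) \<Rightarrow> real) \<Rightarrow> bool" where
  "flat_chain1 S \<longleftrightarrow> current1 S \<and>
     (\<exists>N. (\<forall>k. normal1 (N k)) \<and>
        (\<lambda>k. flat_norm1 (\<lambda>\<omega>. S \<omega> - N k \<omega>)) \<longlonglongrightarrow> 0)"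

definition induced1 :: "((real^'n \<Rightarrow> real) \<Rightarrow> (real^'n \<Rightarrow> real) \<Rightarrow> real) \<Rightarrow> (real^'n \<Rightarrow> real^'n) \<Rightarrow> real" where
  "induced1 T \<omega> = (\<Sum>i\<in>UNIV. T (\<lambda>x. \<omega> x $ i) (\<lambda>x. x $ i))"

end

theory Submission
  imports Defs
begin

text \<open>
  Let \<open>A\<close> be the average of a form over translations by the cube \<open>[0,\<epsilon>]\<^sup>d\<close>.  The functional
  \<open>\<omega> \<mapsto> \<langle>T, A \<omega>\<rangle>\<close> is a normal current: \<open>A\<close> is a sup-norm contraction, and partial derivatives
  of \<open>A \<phi>\<close> are averages of difference quotients of \<open>\<phi>\<close>, hence bounded by \<open>2/\<epsilon>\<close> times \<open>sup |\<phi>|\<close>.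
  If \<open>|\<omega>| \<le> 1\<close> and \<open>|d\<omega>| \<le> 1\<close>, the homotopy formula for translations gives
  \<open>A \<omega> - \<omega> = df + \<theta>\<close> with \<open>|f|, |\<theta>| \<le> d \<epsilon>\<close> and \<open>f\<close> Lipschitz uniformly in \<open>\<epsilon>\<close> and \<open>\<omega>\<close>.
  Then \<open>\<langle>T, \<theta>\<rangle>\<close> is small by finiteness of mass, while \<open>\<langle>T, df\<rangle> = T(1, f)\<close> by the chain rule, which
  tends to \<open>0\<close> by the continuity axiom.  The chain rule follows from mass and locality: near a point \<open>f\<close>
  differs from its tangent affine function by a function of small Lipschitz constant.
\<close>

section \<open>Functions with continuous partial derivatives\<close>

text \<open>\<open>pd\<close> is built from \<open>deriv\<close>, which has some arbitrary value
  where no derivative exists; \<open>has_pds\<close> makes it a genuine partial derivative at every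
  point.\<close>

definition has_pds :: "(real^'n \<Rightarrow> real) \<Rightarrow> bool" where
  "has_pds g \<longleftrightarrow> (\<forall>i x. ((\<lambda>t. g (x + t *\<^sub>R axis i 1)) has_real_derivative pd i g x) (at 0))"

text \<open>\<open>cc\<close>, \<open>cc1\<close> and \<open>cc2\<close> are the classes C_c, C_c^1
  and C_c^2, with compact support expressed as vanishing outside a ball.\<close>

definition cc :: "(real^'n \<Rightarrow> real) \<Rightarrow> bool" where
  "cc g \<longleftrightarrow> continuous_on UNIV g \<and> (\<exists>R. \<forall>x. norm x > R \<longrightarrow> g x = 0)"

definition cc1 :: "(real^'n \<Rightarrow> real) \<Rightarrow> bool" where
  "cc1 g \<longleftrightarrow> cc g \<and> has_pds g \<and> (\<forall>i. cc (pd i g))"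

definition cc2 :: "(real^'n \<Rightarrow> real) \<Rightarrow> bool" where
  "cc2 g \<longleftrightarrow> cc1 g \<and> (\<forall>i. cc1 (pd i g))"

lemma pd_eqI:
  "((\<lambda>t. g (x + t *\<^sub>R axis i 1)) has_real_derivative D) (at 0) \<Longrightarrow> pd i g x = D"
  by (simp add: pd_def DERIV_imp_deriv)

text \<open>Moving the base point turns differentiability at parameter 0 into differentiability
  along a whole line, the form in which the mean value and fundamental theorems are applied.\<close>

lemma has_pds_at:
  assumes "has_pds g"
  shows "((\<lambda>t. g (x + t *\<^sub>R axis i 1)) has_real_derivative pd i g (x + s *\<^sub>R axis i 1)) (at s)"
proof -
  have "((\<lambda>t. g ((x + s *\<^sub>R axis i 1) + t *\<^sub>R axis i 1)) has_real_derivative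
      pd i g (x + s *\<^sub>R axis i 1)) (at 0)"
    using assms unfolding has_pds_def by blast
  moreover have "(\<lambda>t. g ((x + s *\<^sub>R axis i 1) + t *\<^sub>R axis i 1)) =
      (\<lambda>t. g (x + (t + s) *\<^sub>R axis i 1))"
    by (simp add: algebra_simps)
  ultimately show ?thesis
    using DERIV_shift[of "\<lambda>t. g (x + t *\<^sub>R axis i 1)" _ 0 s] by simp
qed

text \<open>The coordinates of \<open>x\<close> are replaced by those of \<open>y\<close> one at a
  time, with the mean value inequality on each axis-parallel segment. The induction is on the set of
  coordinates in which the two points may differ.\<close>

lemma abs_diff_le_of_pd_bound:
  fixes f :: "real^'n \<Rightarrow> real"
  assumes f: "has_pds f" and S: "is_interval S"
    and C: "\<And>i z. z \<in> S \<Longrightarrow> \<bar>pd i f z\<bar> \<le> C"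
    and "finite I" "x \<in> S" "y \<in> S" "\<And>i. i \<notin> I \<Longrightarrow> x $ i = y $ i"
  shows "\<bar>f x - f y\<bar> \<le> C * (\<Sum>i\<in>I. \<bar>x $ i - y $ i\<bar>)"
  using assms(4-)
proof (induction I arbitrary: x rule: finite_induct)
  case empty
  then have "x = y" by (simp add: vec_eq_iff)
  then show ?case by simp
next
  case (insert i I)
  \<comment> \<open>An interval contains all points lying coordinatewise between \<open>x\<close>
    and \<open>y\<close>; this keeps the corner \<open>z\<close> and the segment leading to it
    inside \<open>S\<close>.\<close>
  have box: "z \<in> S" if "\<And>j. (x$j \<le> z$j \<and> z$j \<le> y$j) \<or> (y$j \<le> z$j \<and> z$j \<le> x$j)" for z
    using S insert.prems that unfolding is_interval_cart by blast
  define h where "h = y $ i - x $ i"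
  define z where "z = x + h *\<^sub>R axis i 1"
  have zc: "z $ j = (if j = i then y $ i else x $ j)" for j
    by (simp add: z_def h_def axis_def)
  have zS: "z \<in> S"
    by (rule box) (use linear in \<open>auto simp: zc\<close>)
  have IH: "\<bar>f z - f y\<bar> \<le> C * (\<Sum>j\<in>I. \<bar>z $ j - y $ j\<bar>)"
    by (rule insert.IH) (use insert zS zc in auto)
  have sumeq: "(\<Sum>j\<in>I. \<bar>z $ j - y $ j\<bar>) = (\<Sum>j\<in>I. \<bar>x $ j - y $ j\<bar>)"
    using insert.hyps by (intro sum.cong) (auto simp: zc)
  have seg: "norm (f (x + h *\<^sub>R axis i 1) - f (x + 0 *\<^sub>R axis i 1)) \<le> C * norm (h - 0)"
  proof (rule field_differentiable_bound[of "closed_segment 0 h" "\<lambda>t. f (x + t *\<^sub>R axis i 1)"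
        "\<lambda>t. pd i f (x + t *\<^sub>R axis i 1)"])
    show "((\<lambda>t. f (x + t *\<^sub>R axis i 1)) has_field_derivative pd i f (x + t *\<^sub>R axis i 1))
        (at t within closed_segment 0 h)" for t
      using has_pds_at[OF f] by (rule has_field_derivative_at_within)
    show "norm (pd i f (x + t *\<^sub>R axis i 1)) \<le> C" if t: "t \<in> closed_segment 0 h" for t
    proof -
      have "x + t *\<^sub>R axis i 1 \<in> S"
      proof (rule box)
        fix j
        show "(x$j \<le> (x + t *\<^sub>R axis i 1)$j \<and> (x + t *\<^sub>R axis i 1)$j \<le> y$j) \<or>
            (y$j \<le> (x + t *\<^sub>R axis i 1)$j \<and> (x + t *\<^sub>R axis i 1)$j \<le> x$j)"
        proof (cases "j = i")
          case True
          then show ?thesis using t by (auto simp: axis_def h_def closed_segment_eq_real_ivl split: if_splits)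
        next
          case False
          then show ?thesis using linear by (auto simp: axis_def)
        qed
      qed
      then show ?thesis using C by simp
    qed
  qed auto
  have "\<bar>f x - f y\<bar> \<le> \<bar>f z - f x\<bar> + \<bar>f z - f y\<bar>" by linarith
  also have "\<dots> \<le> C * \<bar>h\<bar> + C * (\<Sum>j\<in>I. \<bar>x $ j - y $ j\<bar>)"
    using seg IH sumeq by (simp add: z_def)
  also have "\<dots> = C * (\<Sum>j\<in>insert i I. \<bar>x $ j - y $ j\<bar>)"
    using insert.hyps by (simp add: h_def algebra_simps abs_minus_commute)
  finally show ?case .
qed

text \<open>The factor \<open>CARD('n)\<close> comes from the crude comparison of the sum of the
  coordinate differences with the Euclidean norm.\<close>

lemma lipschitz_on_of_pd_bound:
  fixes f :: "real^'n \<Rightarrow> real"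
  assumes f: "has_pds f" and S: "is_interval S" and "0 \<le> C"
    and C: "\<And>i z. z \<in> S \<Longrightarrow> \<bar>pd i f z\<bar> \<le> C"
  shows "(C * CARD('n))-lipschitz_on S f"
proof (rule lipschitz_onI)
  fix x y assume xy: "x \<in> S" "y \<in> S"
  have "\<bar>f x - f y\<bar> \<le> C * (\<Sum>i\<in>UNIV. \<bar>x $ i - y $ i\<bar>)"
    by (rule abs_diff_le_of_pd_bound[OF f S C]) (use xy in auto)
  also have "(\<Sum>i\<in>UNIV. \<bar>x $ i - y $ i\<bar>) \<le> of_nat CARD('n) * norm (x - y)"
    by (rule sum_bounded_above) (metis component_le_norm_cart vector_minus_component)
  finally show "dist (f x) (f y) \<le> C * CARD('n) * dist x y"
    using \<open>0 \<le> C\<close> by (simp add: dist_norm mult_left_mono mult.assoc)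
qed (use \<open>0 \<le> C\<close> in simp)

lemma cc_bounded:
  fixes g :: "real^'n \<Rightarrow> real"
  assumes "cc g"
  shows "\<exists>M\<ge>0. \<forall>x. \<bar>g x\<bar> \<le> M"
proof -
  obtain R where R: "\<And>x. norm x > R \<Longrightarrow> g x = 0" using assms unfolding cc_def by blast
  have "compact (g ` cball 0 R)"
    using assms unfolding cc_def
    by (intro compact_continuous_image) (auto intro: continuous_on_subset)
  then obtain M where M: "\<And>x. norm x \<le> R \<Longrightarrow> \<bar>g x\<bar> \<le> M"
    by (metis compact_imp_bounded bounded_iff image_eqI mem_cball_0 real_norm_def)
  have "\<bar>g x\<bar> \<le> max M 0" for x
    using R[of x] M[of x] by (cases "norm x \<le> R") auto
  then show ?thesis by (meson max.cobounded2)
qed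

lemma lipschitz_of_pd_bound:
  fixes f :: "real^'n \<Rightarrow> real"
  assumes "has_pds f" "0 \<le> C" "\<And>i z. \<bar>pd i f z\<bar> \<le> C"
  shows "(C * CARD('n))-lipschitz_on UNIV f"
  using assms by (intro lipschitz_on_of_pd_bound) auto

text \<open>Makes coefficients of test forms, their averages and their first derivatives admissible
  as first arguments of a metric current.\<close>

lemma cc1_lipb:
  fixes g :: "real^'n \<Rightarrow> real"
  assumes "cc1 g"
  shows "lipb g"
proof -
  have "\<forall>i. \<exists>M. \<forall>x. \<bar>pd i g x\<bar> \<le> M"
    using assms cc_bounded unfolding cc1_def by blast
  then obtain M where M: "\<And>i x. \<bar>pd i g x\<bar> \<le> M i" by metis
  have M0: "0 \<le> M i" for i using M[of i 0] by linarith
  have "\<bar>pd i g x\<bar> \<le> (\<Sum>i\<in>UNIV. M i)" for i x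
    using M[of i x] member_le_sum[of i UNIV M] M0 by fastforce
  then have "lipf g"
    unfolding lipf_def using lipschitz_of_pd_bound[of g "\<Sum>i\<in>UNIV. M i"] assms M0
    by (auto simp: cc1_def sum_nonneg)
  then show ?thesis
    using cc_bounded[of g] assms unfolding lipb_def cc1_def by (auto simp: bounded_iff)
qed

lemma has_pds_linear_combination:
  assumes "has_pds f" "has_pds g"
  shows "has_pds (\<lambda>x. a * f x + b * g x)"
    and "pd i (\<lambda>x. a * f x + b * g x) x = a * pd i f x + b * pd i g x"
proof -
  have *: "((\<lambda>t. a * f (x + t *\<^sub>R axis i 1) + b * g (x + t *\<^sub>R axis i 1))
      has_real_derivative (a * pd i f x + b * pd i g x)) (at 0)" for i x
    using assms unfolding has_pds_def by (intro DERIV_add DERIV_cmult) auto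
  show pd: "pd i (\<lambda>x. a * f x + b * g x) x = a * pd i f x + b * pd i g x" for i x
    using * by (rule pd_eqI)
  show "has_pds (\<lambda>x. a * f x + b * g x)"
    unfolding has_pds_def pd using * by simp
qed

lemma cc_linear_combination:
  assumes "cc f" "cc g"
  shows "cc (\<lambda>x. a * f x + b * g x)"
proof -
  obtain R1 R2 where "\<forall>x. norm x > R1 \<longrightarrow> f x = 0" "\<forall>x. norm x > R2 \<longrightarrow> g x = 0"
    using assms unfolding cc_def by blast
  then have "\<forall>x. norm x > max R1 R2 \<longrightarrow> a * f x + b * g x = 0" by simp
  then show ?thesis
    using assms unfolding cc_def
    by (intro conjI continuous_intros exI[of _ "max R1 R2"]) auto
qed

lemma cc1_linear_combination:
  assumes "cc1 f" "cc1 g"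
  shows "cc1 (\<lambda>x. a * f x + b * g x)"
proof -
  have "pd i (\<lambda>x. a * f x + b * g x) = (\<lambda>x. a * pd i f x + b * pd i g x)" for i
    using assms by (intro ext has_pds_linear_combination) (auto simp: cc1_def)
  then show ?thesis
    using assms unfolding cc1_def by (simp add: has_pds_linear_combination cc_linear_combination)
qed

lemma cc2_linear_combination:
  assumes "cc2 f" "cc2 g"
  shows "cc2 (\<lambda>x. a * f x + b * g x)"
proof -
  have "pd i (\<lambda>x. a * f x + b * g x) = (\<lambda>x. a * pd i f x + b * pd i g x)" for i
    using assms by (intro ext has_pds_linear_combination) (auto simp: cc1_def cc2_def)
  then show ?thesis
    using assms unfolding cc2_def by (simp add: cc1_linear_combination)
qed

lemma zero_cc2: "cc2 (\<lambda>x::real^'n. 0)"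
proof -
  have z: "has_pds (\<lambda>x::real^'n. 0)" "pd i (\<lambda>x::real^'n. 0) = (\<lambda>x. 0)" for i
    by (auto simp: has_pds_def pd_def)
  show ?thesis by (simp add: cc2_def cc1_def cc_def z)
qed

lemma pd_zero_outside:
  fixes g :: "real^'n \<Rightarrow> real"
  assumes R: "\<And>x. norm x > R \<Longrightarrow> g x = 0" and x: "norm x > R"
  shows "pd i g x = 0"
proof (rule pd_eqI)
  have "open ((\<lambda>t::real. x + t *\<^sub>R axis i 1) -` {y. norm y > R})"
    by (intro open_vimage continuous_intros open_Collect_less) 
  then show "((\<lambda>t. g (x + t *\<^sub>R axis i 1)) has_real_derivative 0) (at 0)"
    using x R by (intro has_field_derivative_transform_within_open[OF DERIV_const[of 0]]) auto
qed

text \<open>All iterated derivatives \<open>pdl \<alpha> \<phi>\<close> are continuous and vanish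
  outside the same ball as \<open>\<phi>\<close>; index lists of length 0 and 1 then give the C^2
  statement.\<close>

lemma test0_cc2:
  fixes \<phi> :: "real^'n \<Rightarrow> real"
  assumes "test0 \<phi>"
  shows "cc2 \<phi>"
proof -
  have sm: "smooth_fun \<phi>" using assms by (simp add: test0_def)
  have "bounded {x. \<phi> x \<noteq> 0}"
    using assms unfolding test0_def by (meson bounded_subset closure_subset compact_imp_bounded)
  then obtain R where R: "\<And>x. norm x > R \<Longrightarrow> \<phi> x = 0"
    by (metis (mono_tags, lifting) bounded_iff linorder_not_le mem_Collect_eq)
  have pz: "pdl \<alpha> \<phi> x = 0" if "norm x > R" for \<alpha> x
    using that by (induction \<alpha> arbitrary: x) (auto intro: R pd_zero_outside)
  have c: "cc (pdl \<alpha> \<phi>)" for \<alpha>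
    using sm pz unfolding cc_def smooth_fun_def by blast
  have d: "has_pds (pdl \<alpha> \<phi>)" for \<alpha>
    using sm unfolding has_pds_def smooth_fun_def pd_def
    by (auto simp: field_differentiable_derivI)
  have "cc1 (pdl \<alpha> \<phi>)" for \<alpha>
    unfolding cc1_def using c d c[of "_ # \<alpha>"] by simp
  from this[of "[]"] this[of "[_]"] show ?thesis by (simp add: cc2_def)
qed

section \<open>Directional averages\<close>

text \<open>A weighted average over translations in a single direction. Averages over cubes are
  obtained by iteration, so that only one-dimensional integrals occur.\<close>

definition avg :: "'n \<Rightarrow> real \<Rightarrow> (real \<Rightarrow> real) \<Rightarrow> (real^'n \<Rightarrow> real) \<Rightarrow> real^'n \<Rightarrow> real" where
  "avg k \<epsilon> w g x = integral {0..\<epsilon>} (\<lambda>t. w t * g (x + t *\<^sub>R axis k 1))"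

lemma avg_integrable:
  fixes g :: "real^'n \<Rightarrow> real"
  assumes "continuous_on UNIV w" "continuous_on UNIV g"
  shows "(\<lambda>t. w t * g (x + t *\<^sub>R axis k 1)) integrable_on {0..\<epsilon>}"
  using assms
  by (intro integrable_continuous_real continuous_intros continuous_on_compose2[OF assms(1)]
      continuous_on_compose2[OF assms(2)]) auto

lemma avg_linear_combination:
  fixes f g :: "real^'n \<Rightarrow> real"
  assumes "continuous_on UNIV w" "continuous_on UNIV f" "continuous_on UNIV g"
  shows "avg k \<epsilon> w (\<lambda>x. a * f x + b * g x) x = a * avg k \<epsilon> w f x + b * avg k \<epsilon> w g x"
proof -
  have "avg k \<epsilon> w (\<lambda>x. a * f x + b * g x) x = integral {0..\<epsilon>} (\<lambda>t.
      a * (w t * f (x + t *\<^sub>R axis k 1)) + b * (w t * g (x + t *\<^sub>R axis k 1)))"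
    unfolding avg_def by (simp add: algebra_simps)
  also have "\<dots> = integral {0..\<epsilon>} (\<lambda>t. a * (w t * f (x + t *\<^sub>R axis k 1))) +
      integral {0..\<epsilon>} (\<lambda>t. b * (w t * g (x + t *\<^sub>R axis k 1)))"
    using avg_integrable[OF assms(1,2)] avg_integrable[OF assms(1,3)]
    by (intro Henstock_Kurzweil_Integration.integral_add integrable_on_mult_right) auto
  finally show ?thesis by (simp add: avg_def)
qed

lemma avg_bound:
  fixes g :: "real^'n \<Rightarrow> real"
  assumes "continuous_on UNIV w" "continuous_on UNIV g" "0 \<le> \<epsilon>"
    and "\<And>t. t \<in> {0..\<epsilon>} \<Longrightarrow> \<bar>w t\<bar> \<le> W" "\<And>x. \<bar>g x\<bar> \<le> M"
  shows "\<bar>avg k \<epsilon> w g x\<bar> \<le> W * M * \<epsilon>"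
proof -
  have "norm (integral {0..\<epsilon>} (\<lambda>t. w t * g (x + t *\<^sub>R axis k 1))) \<le> W * M * (\<epsilon> - 0)"
  proof (rule integral_bound)
    show "continuous_on {0..\<epsilon>} (\<lambda>t. w t * g (x + t *\<^sub>R axis k 1))"
      by (intro continuous_intros continuous_on_compose2[OF assms(1)]
          continuous_on_compose2[OF assms(2)]) auto
    show "norm (w t * g (x + t *\<^sub>R axis k 1)) \<le> W * M" if "t \<in> {0..\<epsilon>}" for t
      using assms(4)[OF that] assms(5)[of "x + t *\<^sub>R axis k 1"]
      by (simp add: abs_mult mult_mono')
  qed (use assms in auto)
  then show ?thesis by (simp add: avg_def)
qed

lemma avg_cc:
  fixes g :: "real^'n \<Rightarrow> real"
  assumes w: "continuous_on UNIV w" and g: "cc g"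
  shows "cc (avg k \<epsilon> w g)"
proof -
  have cg: "continuous_on UNIV g" using g by (simp add: cc_def)
  have "continuous_on UNIV (\<lambda>x. integral (cbox 0 \<epsilon>) (\<lambda>t. w t * g (x + t *\<^sub>R axis k 1)))"
  proof (rule integral_continuous_on_param)
    have "continuous_on (UNIV \<times> cbox 0 \<epsilon>)
        (\<lambda>p::(real^'n) \<times> real. w (snd p) * g (fst p + snd p *\<^sub>R axis k 1))"
      by (intro continuous_intros continuous_on_compose2[OF w] continuous_on_compose2[OF cg]) auto
    then show "continuous_on (UNIV \<times> cbox 0 \<epsilon>)
        (\<lambda>(x::real^'n, t). w t * g (x + t *\<^sub>R axis k 1))"
      by (simp add: case_prod_beta')
  qed
  then have "continuous_on UNIV (avg k \<epsilon> w g)"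
    unfolding avg_def[abs_def] by simp
  moreover obtain R where R: "\<And>x. norm x > R \<Longrightarrow> g x = 0" using g unfolding cc_def by blast
  \<comment> \<open>A translation by \<open>t\<close> in \<open>{0..\<epsilon>}\<close> moves a
    point by at most \<open>\<bar>\<epsilon>\<bar>\<close>, so the support grows by no more than
    that.\<close>
  have "avg k \<epsilon> w g x = 0" if x: "norm x > R + \<bar>\<epsilon>\<bar>" for x
  proof -
    have "w t * g (x + t *\<^sub>R axis k 1) = 0" if "t \<in> {0..\<epsilon>}" for t
    proof -
      have "norm x \<le> norm (x + t *\<^sub>R axis k 1) + norm (t *\<^sub>R axis k (1::real))"
        by (metis add_diff_cancel_right' norm_triangle_ineq4)
      then show ?thesis using x that by (simp add: R norm_axis_1)
    qed
    then have "integral {0..\<epsilon>} (\<lambda>t. w t * g (x + t *\<^sub>R axis k 1)) = integral {0..\<epsilon>} (\<lambda>t. 0)"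
      by (intro integral_cong) auto
    then show ?thesis by (simp add: avg_def)
  qed
  ultimately show ?thesis unfolding cc_def by blast
qed

text \<open>Differentiation under the integral sign: averaging commutes with partial derivatives in
  every direction.\<close>

lemma avg_has_pd:
  fixes g :: "real^'n \<Rightarrow> real"
  assumes w: "continuous_on UNIV w" and g: "cc1 g"
  shows "((\<lambda>s. avg k \<epsilon> w g (x + s *\<^sub>R axis i 1)) has_real_derivative avg k \<epsilon> w (pd i g) x) (at 0)"
proof -
  have cg: "continuous_on UNIV g" and cp: "continuous_on UNIV (pd i g)" and d: "has_pds g"
    using g by (simp_all add: cc_def cc1_def)
  have "((\<lambda>s. integral (cbox 0 \<epsilon>) (\<lambda>t. w t * g ((x + s *\<^sub>R axis i 1) + t *\<^sub>R axis k 1)))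
      has_field_derivative
      integral (cbox 0 \<epsilon>) (\<lambda>t. w t * pd i g ((x + 0 *\<^sub>R axis i 1) + t *\<^sub>R axis k 1))) (at 0 within UNIV)"
  proof (rule leibniz_rule_field_derivative)
    show "((\<lambda>s. w t * g (x + s *\<^sub>R axis i 1 + t *\<^sub>R axis k 1)) has_field_derivative
        w t * pd i g (x + s *\<^sub>R axis i 1 + t *\<^sub>R axis k 1)) (at s within UNIV)" for s t
      using DERIV_cmult[OF has_pds_at[OF d, of "x + t *\<^sub>R axis k 1" i s], of "w t"]
      by (simp add: algebra_simps)
    show "(\<lambda>t. w t * g (x + s *\<^sub>R axis i 1 + t *\<^sub>R axis k 1)) integrable_on cbox 0 \<epsilon>" for s
      using avg_integrable[OF w cg] by simp
    have "continuous_on (UNIV \<times> cbox 0 \<epsilon>) (\<lambda>p::real \<times> real.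
        w (snd p) * pd i g (x + fst p *\<^sub>R axis i 1 + snd p *\<^sub>R axis k 1))"
      by (intro continuous_intros continuous_on_compose2[OF w] continuous_on_compose2[OF cp]) auto
    then show "continuous_on (UNIV \<times> cbox 0 \<epsilon>)
        (\<lambda>(s, t). w t * pd i g (x + s *\<^sub>R axis i 1 + t *\<^sub>R axis k 1))"
      by (simp add: case_prod_beta')
  qed auto
  then show ?thesis by (simp add: avg_def)
qed

lemma pd_avg:
  assumes "continuous_on UNIV w" "cc1 g"
  shows "pd i (avg k \<epsilon> w g) = avg k \<epsilon> w (pd i g)"
  using pd_eqI[OF avg_has_pd[OF assms]] by blast

lemma avg_cc1:
  assumes "continuous_on UNIV w" "cc1 g"
  shows "cc1 (avg k \<epsilon> w g)"
  using avg_has_pd[OF assms] assms(2)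
  by (simp add: cc1_def has_pds_def pd_avg[OF assms] avg_cc[OF assms(1)])

lemma avg_cc2:
  assumes "continuous_on UNIV w" "cc2 g"
  shows "cc2 (avg k \<epsilon> w g)"
  using assms avg_cc1 by (auto simp: cc2_def pd_avg)

section \<open>Uniform averages and the homotopy weight\<close>

definition mean :: "real \<Rightarrow> 'n \<Rightarrow> (real^'n \<Rightarrow> real) \<Rightarrow> real^'n \<Rightarrow> real" where
  "mean \<epsilon> k = avg k \<epsilon> (\<lambda>_. 1 / \<epsilon>)"

text \<open>The weight arises by averaging over \<open>t\<close> in \<open>{0..\<epsilon>}\<close>
  the integral of a function over \<open>{0..t}\<close>: exchanging the integrals leaves the factor
  \<open>1 - s / \<epsilon>\<close> at the point \<open>s\<close>.\<close>

definition hmean :: "real \<Rightarrow> 'n \<Rightarrow> (real^'n \<Rightarrow> real) \<Rightarrow> real^'n \<Rightarrow> real" where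
  "hmean \<epsilon> k = avg k \<epsilon> (\<lambda>t. 1 - t / \<epsilon>)"

lemma weight_continuous:
  "continuous_on UNIV (\<lambda>_::real. 1 / \<epsilon> :: real)" "continuous_on UNIV (\<lambda>t::real. 1 - t / \<epsilon>)"
proof -
  show "continuous_on UNIV (\<lambda>t::real. 1 - t / \<epsilon>)"
    unfolding divide_inverse by (intro continuous_intros)
qed auto

lemma mean_bound:
  fixes g :: "real^'n \<Rightarrow> real"
  assumes "0 < \<epsilon>" "continuous_on UNIV g" "\<And>x. \<bar>g x\<bar> \<le> M"
  shows "\<bar>mean \<epsilon> k g x\<bar> \<le> M"
  using avg_bound[OF weight_continuous(1) assms(2), where W = "1 / \<epsilon>" and M = M and \<epsilon> = \<epsilon>] assms
  by (simp add: mean_def)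

text \<open>The weight lies between 0 and 1 on a segment of length \<open>\<epsilon>\<close>. This
  factor \<open>\<epsilon>\<close> makes the terms of the homotopy formula small.\<close>

lemma hmean_bound:
  fixes g :: "real^'n \<Rightarrow> real"
  assumes "0 < \<epsilon>" "continuous_on UNIV g" "\<And>x. \<bar>g x\<bar> \<le> M"
  shows "\<bar>hmean \<epsilon> k g x\<bar> \<le> M * \<epsilon>"
  using avg_bound[OF weight_continuous(2) assms(2), where W = 1 and M = M and \<epsilon> = \<epsilon>] assms
  by (simp add: hmean_def)

text \<open>By the fundamental theorem of calculus, averaging a derivative in its own direction
  leaves a difference quotient. Finiteness of the boundary mass of the approximations rests on
  this.\<close>

lemma mean_pd_same:
  fixes g :: "real^'n \<Rightarrow> real"
  assumes "0 < \<epsilon>" "cc1 g"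
  shows "mean \<epsilon> k (pd k g) x = (g (x + \<epsilon> *\<^sub>R axis k 1) - g x) / \<epsilon>"
proof -
  have "((\<lambda>t. pd k g (x + t *\<^sub>R axis k 1)) has_integral
      (g (x + \<epsilon> *\<^sub>R axis k 1) - g (x + 0 *\<^sub>R axis k 1))) {0..\<epsilon>}"
    using assms has_pds_at[of g]
    by (intro fundamental_theorem_of_calculus)
      (auto simp: cc1_def has_real_derivative_iff_has_vector_derivative[symmetric]
        intro: has_field_derivative_at_within)
  then have "integral {0..\<epsilon>} (\<lambda>t. pd k g (x + t *\<^sub>R axis k 1)) = g (x + \<epsilon> *\<^sub>R axis k 1) - g x"
    by (simp add: integral_unique)
  then show ?thesis by (simp add: mean_def avg_def)
qed

text \<open>The derivative of the function \<open>t \<mapsto> (1 - t/\<epsilon>) g(x + t e\<^sub>k)\<close> integrates to \<open>- g x\<close>.\<close>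

lemma mean_diff:
  fixes g :: "real^'n \<Rightarrow> real"
  assumes "0 < \<epsilon>" "cc1 g"
  shows "mean \<epsilon> k g x - g x = hmean \<epsilon> k (pd k g) x"
proof -
  have cg: "continuous_on UNIV g" and cp: "continuous_on UNIV (pd k g)" and d: "has_pds g"
    using assms by (simp_all add: cc_def cc1_def)
  let ?w = "\<lambda>t::real. 1 - t / \<epsilon>"
  have "((\<lambda>t. ?w t * g (x + t *\<^sub>R axis k 1)) has_real_derivative
      ?w t * pd k g (x + t *\<^sub>R axis k 1) - 1 / \<epsilon> * g (x + t *\<^sub>R axis k 1)) (at t)" for t
  proof -
    have "(?w has_real_derivative - (1 / \<epsilon>)) (at t)"
      using DERIV_diff[OF DERIV_const[of 1] DERIV_cdivide[OF DERIV_ident]] by simp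
    from DERIV_mult[OF this has_pds_at[OF d, of x k t]] show ?thesis
      by (simp add: algebra_simps)
  qed
  then have "((\<lambda>t. ?w t * pd k g (x + t *\<^sub>R axis k 1) - 1 / \<epsilon> * g (x + t *\<^sub>R axis k 1)) has_integral
      ?w \<epsilon> * g (x + \<epsilon> *\<^sub>R axis k 1) - ?w 0 * g (x + 0 *\<^sub>R axis k 1)) {0..\<epsilon>}"
    using assms(1)
    by (intro fundamental_theorem_of_calculus)
      (auto simp: has_real_derivative_iff_has_vector_derivative[symmetric]
        intro: has_field_derivative_at_within)
  then have "integral {0..\<epsilon>} (\<lambda>t. ?w t * pd k g (x + t *\<^sub>R axis k 1) - 1 / \<epsilon> * g (x + t *\<^sub>R axis k 1))
      = - g x"
    using assms(1) by (simp add: integral_unique)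
  moreover have "integral {0..\<epsilon>} (\<lambda>t. ?w t * pd k g (x + t *\<^sub>R axis k 1) - 1 / \<epsilon> * g (x + t *\<^sub>R axis k 1))
      = hmean \<epsilon> k (pd k g) x - mean \<epsilon> k g x"
    unfolding hmean_def mean_def avg_def
    by (intro Henstock_Kurzweil_Integration.integral_diff avg_integrable weight_continuous cg cp)
  ultimately show ?thesis by linarith
qed

text \<open>If \<open>ks\<close> lists every direction once, this is the average over translations
  by the cube of side \<open>\<epsilon>\<close>; a repeated direction is simply averaged
  again.\<close>

fun means :: "real \<Rightarrow> 'n list \<Rightarrow> (real^'n \<Rightarrow> real) \<Rightarrow> real^'n \<Rightarrow> real" where
  "means \<epsilon> [] g = g"
| "means \<epsilon> (k # ks) g = mean \<epsilon> k (means \<epsilon> ks g)"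

lemma means_cc1: "cc1 g \<Longrightarrow> cc1 (means \<epsilon> ks g)"
  by (induction ks) (auto simp: mean_def avg_cc1)

lemma means_cc2: "cc2 g \<Longrightarrow> cc2 (means \<epsilon> ks g)"
  by (induction ks) (auto simp: mean_def avg_cc2)

lemma cc1_continuous: "cc1 g \<Longrightarrow> continuous_on UNIV g"
  by (simp add: cc1_def cc_def)

lemma pd_means: "cc1 g \<Longrightarrow> pd i (means \<epsilon> ks g) = means \<epsilon> ks (pd i g)"
  by (induction ks) (simp_all add: mean_def pd_avg means_cc1 weight_continuous)

lemma means_bound:
  fixes g :: "real^'n \<Rightarrow> real"
  assumes "0 < \<epsilon>" "cc1 g" "\<And>x. \<bar>g x\<bar> \<le> M"
  shows "\<bar>means \<epsilon> ks g x\<bar> \<le> M"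
  using assms
  by (induction ks arbitrary: x) (auto intro!: mean_bound cc1_continuous means_cc1)

lemma means_linear_combination:
  fixes f g :: "real^'n \<Rightarrow> real"
  assumes "cc1 f" "cc1 g"
  shows "means \<epsilon> ks (\<lambda>x. a * f x + b * g x) = (\<lambda>x. a * means \<epsilon> ks f x + b * means \<epsilon> ks g x)"
proof (induction ks)
  case (Cons k ks)
  then show ?case
    using assms by (auto simp: mean_def intro!: avg_linear_combination cc1_continuous means_cc1)
qed simp

text \<open>One of the averages acts in direction \<open>i\<close> and yields a difference quotient
  of a function bounded by \<open>M\<close>; the averages applied after it are contractions.\<close>

lemma means_pd_bound:
  fixes g :: "real^'n \<Rightarrow> real"
  assumes "0 < \<epsilon>" "cc2 g" "\<And>x. \<bar>g x\<bar> \<le> M" "i \<in> set ks"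
  shows "\<bar>means \<epsilon> ks (pd i g) x\<bar> \<le> 2 * M / \<epsilon>"
  using assms(4)
proof (induction ks arbitrary: x)
  case (Cons k ks)
  have c: "cc1 g" "cc1 (pd i g)" using assms(2) by (auto simp: cc2_def)
  show ?case
  proof (cases "i \<in> set ks")
    case True
    then show ?thesis
      using Cons c by (auto intro!: mean_bound cc1_continuous means_cc1 assms(1))
  next
    case False
    \<comment> \<open>This is the last occurrence of \<open>i\<close> in the list. The averages in
      \<open>ks\<close> commute with the derivative, so the outer one integrates the derivative of
      \<open>?h\<close>.\<close>
    then have k: "k = i" using Cons.prems by simp
    let ?h = "means \<epsilon> ks g"
    have "means \<epsilon> (k # ks) (pd i g) x = (?h (x + \<epsilon> *\<^sub>R axis k 1) - ?h x) / \<epsilon>"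
      using mean_pd_same[OF assms(1) means_cc1[OF c(1), of \<epsilon> ks], of k x] c k
      by (simp add: pd_means)
    moreover have hM: "\<bar>?h y\<bar> \<le> M" for y
      using means_bound assms c by blast
    have "\<bar>?h (x + \<epsilon> *\<^sub>R axis k 1) - ?h x\<bar> \<le> 2 * M"
      using hM[of "x + \<epsilon> *\<^sub>R axis k 1"] hM[of x] by linarith
    ultimately show ?thesis
      using assms(1) by (simp add: abs_divide divide_right_mono)
  qed
qed simp

text \<open>A discrete homotopy formula: with \<open>f\<close> the \<open>hmean\<close> of \<open>\<omega>\<^sub>k\<close> one has
  \<open>mean \<omega>\<^sub>j - \<omega>\<^sub>j = hmean (\<partial>\<^sub>k \<omega>\<^sub>j) = \<partial>\<^sub>j f + hmean (\<partial>\<^sub>k \<omega>\<^sub>j - \<partial>\<^sub>j \<omega>\<^sub>k)\<close>, and one sums over the directions.\<close>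

lemma means_homotopy:
  fixes \<omega> :: "'n \<Rightarrow> real^'n \<Rightarrow> real" and \<epsilon> :: real
  assumes e: "0 < \<epsilon>" and c: "\<And>j. cc2 (\<omega> j)" and b: "\<And>j x. \<bar>\<omega> j x\<bar> \<le> 1"
    and cb: "\<And>i j x. \<bar>pd i (\<omega> j) x - pd j (\<omega> i) x\<bar> \<le> 1"
  shows "\<exists>f \<theta>. cc2 f \<and> (\<forall>j. cc1 (\<theta> j)) \<and> (\<forall>x. \<bar>f x\<bar> \<le> length ks * \<epsilon>) \<and>
    (\<forall>j x. \<bar>\<theta> j x\<bar> \<le> length ks * \<epsilon>) \<and>
    (\<forall>j x. means \<epsilon> ks (\<omega> j) x - \<omega> j x = pd j f x + \<theta> j x)"
proof (induction ks)
  case Nil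
  have "cc1 (\<lambda>x::real^'n. 0)" using zero_cc2 unfolding cc2_def by blast
  then show ?case
    by (intro exI[of _ "\<lambda>x. 0"] exI[of _ "\<lambda>j x. 0"]) (auto simp: zero_cc2 pd_def)
next
  case (Cons k ks)
  then obtain f \<theta> where f: "cc2 f" "\<And>x. \<bar>f x\<bar> \<le> length ks * \<epsilon>"
    and t: "\<And>j. cc1 (\<theta> j)" "\<And>j x. \<bar>\<theta> j x\<bar> \<le> length ks * \<epsilon>"
    and eq: "\<And>j x. means \<epsilon> ks (\<omega> j) x - \<omega> j x = pd j f x + \<theta> j x"
    by blast
  define \<eta> where "\<eta> j = means \<epsilon> ks (\<omega> j)" for j
  have c1: "cc1 (\<omega> j)" "cc1 (pd i (\<omega> j))" for i j using c by (auto simp: cc2_def)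
  have n2: "cc2 (\<eta> j)" for j by (simp add: \<eta>_def means_cc2 c)
  then have n1: "cc1 (\<eta> j)" "cc1 (pd i (\<eta> j))" for i j by (auto simp: cc2_def)
  \<comment> \<open>The components of the exterior derivative of the averaged form in the directions
    \<open>k\<close> and \<open>j\<close>. Averages commute with \<open>pd\<close> and contract, so
    the bound \<open>cb\<close> carries over. The explicit coefficients fit the linear combination
    lemmas.\<close>
  define q where "q j = (\<lambda>x. 1 * pd k (\<eta> j) x + (-1) * pd j (\<eta> k) x)" for j
  have q1: "cc1 (q j)" for j unfolding q_def by (intro cc1_linear_combination n1)
  have qb: "\<bar>q j x\<bar> \<le> 1" for j x
  proof -
    have q: "q j = means \<epsilon> ks (\<lambda>x. 1 * pd k (\<omega> j) x + (-1) * pd j (\<omega> k) x)"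
      unfolding q_def \<eta>_def pd_means[OF c1(1)] by (rule means_linear_combination[symmetric]) (rule c1)+
    have c: "cc1 (\<lambda>x. 1 * pd k (\<omega> j) x + (-1) * pd j (\<omega> k) x)"
      by (intro cc1_linear_combination c1)
    show ?thesis unfolding q by (rule means_bound[OF e c]) (use cb in simp)
  qed
  have nb: "\<bar>\<eta> j x\<bar> \<le> 1" for j x
    unfolding \<eta>_def by (rule means_bound[OF e c1(1) b])
  have hc: "cc1 (hmean \<epsilon> k g)" if "cc1 g" for g
    using that by (simp add: hmean_def avg_cc1 weight_continuous)
  \<comment> \<open>The new direction adds one \<open>hmean\<close> term to the potential and one to
    the remainder, each of size at most \<open>\<epsilon>\<close>.\<close>
  let ?f = "\<lambda>x. 1 * f x + 1 * hmean \<epsilon> k (\<eta> k) x"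
  let ?\<theta> = "\<lambda>j x. 1 * \<theta> j x + 1 * hmean \<epsilon> k (q j) x"
  have h2: "cc2 (hmean \<epsilon> k (\<eta> k))"
    by (simp add: hmean_def avg_cc2 weight_continuous n2)
  show ?case
  proof (intro exI[of _ ?f] exI[of _ ?\<theta>] conjI allI)
    show "cc2 ?f" by (intro cc2_linear_combination f h2)
    show "cc1 (?\<theta> j)" for j by (intro cc1_linear_combination t hc q1)
    show "\<bar>?f x\<bar> \<le> length (k # ks) * \<epsilon>" for x
      using f(2)[of x] hmean_bound[OF e cc1_continuous[OF n1(1)] nb, of k k x]
      by (simp add: algebra_simps)
    show "\<bar>?\<theta> j x\<bar> \<le> length (k # ks) * \<epsilon>" for j x
      using t(2)[of j x] hmean_bound[OF e cc1_continuous[OF q1] qb, of k j x]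
      by (simp add: algebra_simps)
    fix j x
    have "hmean \<epsilon> k (q j) x = hmean \<epsilon> k (pd k (\<eta> j)) x - hmean \<epsilon> k (pd j (\<eta> k)) x"
      unfolding q_def hmean_def
      by (subst avg_linear_combination) (auto intro!: weight_continuous cc1_continuous n1)
    moreover have "pd j ?f x = pd j f x + hmean \<epsilon> k (pd j (\<eta> k)) x"
      using f h2 n1 by (subst has_pds_linear_combination)
        (auto simp: cc2_def cc1_def hmean_def pd_avg weight_continuous)
    moreover have "means \<epsilon> (k # ks) (\<omega> j) x - \<eta> j x = hmean \<epsilon> k (pd k (\<eta> j)) x"
      using mean_diff[OF e n1(1)] by (simp add: \<eta>_def)
    ultimately show "means \<epsilon> (k # ks) (\<omega> j) x - \<omega> j x = pd j ?f x + ?\<theta> j x"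
      using eq[of j x] by (simp add: \<eta>_def)
  qed
qed

section \<open>Metric currents\<close>

lemma lipb_lipf: "lipb f \<Longrightarrow> lipf f"
  by (simp add: lipb_def)

lemma lipb_bounded:
  assumes "lipb f"
  obtains M where "\<And>x. \<bar>f x\<bar> \<le> M"
  using assms unfolding lipb_def bounded_iff by auto

lemma lipf_lipschitz:
  assumes "lipf f"
  obtains C where "C-lipschitz_on UNIV f" "0 \<le> C"
  using assms lipschitz_on_nonneg unfolding lipf_def by blast

lemma lipbI:
  assumes "C-lipschitz_on UNIV f" "\<And>x. \<bar>f x\<bar> \<le> M"
  shows "lipb f"
  using assms unfolding lipb_def lipf_def bounded_iff by auto

lemma lipf_linear_combination:
  assumes "lipf f" "lipf g"
  shows "lipf (\<lambda>x. a * f x + b * g x)"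
proof -
  obtain C D where "C-lipschitz_on UNIV f" "D-lipschitz_on UNIV g"
    using assms unfolding lipf_def by blast
  then have "(\<bar>a\<bar> * C + \<bar>b\<bar> * D)-lipschitz_on UNIV (\<lambda>x. a * f x + b * g x)"
    by (intro lipschitz_on_add lipschitz_on_cmult_real)
  then show ?thesis unfolding lipf_def by blast
qed

lemma lipb_linear_combination:
  assumes "lipb f" "lipb g"
  shows "lipb (\<lambda>x. a * f x + b * g x)"
proof -
  obtain M where M: "\<And>x. \<bar>f x\<bar> \<le> M" using lipb_bounded[OF assms(1)] by blast
  obtain N where N: "\<And>x. \<bar>g x\<bar> \<le> N" using lipb_bounded[OF assms(2)] by blast
  obtain C where C: "C-lipschitz_on UNIV (\<lambda>x. a * f x + b * g x)"
    using lipf_lipschitz[OF lipf_linear_combination[OF assms[THEN lipb_lipf]]] by blast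
  show ?thesis
  proof (rule lipbI[OF C])
    fix x
    have "\<bar>a * f x + b * g x\<bar> \<le> \<bar>a * f x\<bar> + \<bar>b * g x\<bar>" by linarith
    also have "\<dots> \<le> \<bar>a\<bar> * M + \<bar>b\<bar> * N"
      using M[of x] N[of x] by (auto simp: abs_mult intro!: add_mono mult_left_mono)
    finally show "\<bar>a * f x + b * g x\<bar> \<le> \<bar>a\<bar> * M + \<bar>b\<bar> * N" .
  qed
qed

lemma lipb_mult:
  assumes "lipb f" "lipb g"
  shows "lipb (\<lambda>x. f x * g x)"
proof -
  obtain M where M: "\<And>x. \<bar>f x\<bar> \<le> M" using lipb_bounded[OF assms(1)] by blast
  obtain N where N: "\<And>x. \<bar>g x\<bar> \<le> N" using lipb_bounded[OF assms(2)] by blast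
  obtain C where C: "C-lipschitz_on UNIV f" "0 \<le> C"
    using lipf_lipschitz[OF lipb_lipf[OF assms(1)]] by blast
  obtain D where D: "D-lipschitz_on UNIV g" "0 \<le> D"
    using lipf_lipschitz[OF lipb_lipf[OF assms(2)]] by blast
  have M0: "0 \<le> M" "0 \<le> N" using M[of 0] N[of 0] by linarith+
  have "(M * D + C * N)-lipschitz_on UNIV (\<lambda>x. f x * g x)"
  proof (rule lipschitz_onI)
    fix x y
    have "\<bar>f x - f y\<bar> \<le> C * dist x y" "\<bar>g x - g y\<bar> \<le> D * dist x y"
      using lipschitz_onD[OF C(1)] lipschitz_onD[OF D(1)] by (auto simp: dist_real_def)
    then have "\<bar>f x\<bar> * \<bar>g x - g y\<bar> + \<bar>f x - f y\<bar> * \<bar>g y\<bar> \<le>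
        M * (D * dist x y) + (C * dist x y) * N"
      using M[of x] N[of y] M0 C(2) D(2) by (intro add_mono mult_mono) auto
    moreover have "f x * g x - f y * g y = f x * (g x - g y) + (f x - f y) * g y"
      by (simp add: algebra_simps)
    then have "\<bar>f x * g x - f y * g y\<bar> \<le> \<bar>f x\<bar> * \<bar>g x - g y\<bar> + \<bar>f x - f y\<bar> * \<bar>g y\<bar>"
      by (metis abs_mult abs_triangle_ineq)
    ultimately show "dist (f x * g x) (f y * g y) \<le> (M * D + C * N) * dist x y"
      by (simp add: dist_real_def algebra_simps)
  qed (use M0 C(2) D(2) in simp)
  moreover have "\<bar>f x * g x\<bar> \<le> M * N" for x
    using M[of x] N[of x] M0 by (auto simp: abs_mult intro: mult_mono)
  ultimately show ?thesis by (rule lipbI)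
qed

lemma lipb_const: "lipb (\<lambda>x. c)"
  by (rule lipbI[of 0 _ "\<bar>c\<bar>"]) (auto intro: lipschitz_on_constant)

lemma lipschitz_coordinate: "1-lipschitz_on UNIV (\<lambda>x::real^'n. x $ i)"
  by (rule lipschitz_onI) (auto simp: dist_vec_nth_le)

lemma lipf_coordinate: "lipf (\<lambda>x::real^'n. x $ i)"
  using lipschitz_coordinate unfolding lipf_def by blast

section \<open>Integration against the mass measure\<close>

lemma lipb_integrable:
  fixes f :: "real^'n \<Rightarrow> real"
  assumes "finite_measure \<mu>" "sets \<mu> = sets borel" "lipb f"
  shows "integrable \<mu> (\<lambda>x. \<bar>f x\<bar>)"
proof -
  interpret finite_measure \<mu> by fact
  obtain M where M: "\<And>x. \<bar>f x\<bar> \<le> M" using assms(3) lipb_bounded by blast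
  obtain C where "C-lipschitz_on UNIV f" using assms(3) lipb_lipf unfolding lipf_def by blast
  then have "continuous_on UNIV f" by (rule lipschitz_on_continuous_on)
  then have "f \<in> borel_measurable \<mu>"
    using borel_measurable_continuous_onI measurable_cong_sets[OF assms(2) refl] by blast
  then show ?thesis
    by (intro integrable_const_bound[where B = M]) (use M in auto)
qed

lemma lipb_integral_le:
  fixes f :: "real^'n \<Rightarrow> real"
  assumes "finite_measure \<mu>" "sets \<mu> = sets borel" "lipb f" "\<And>x. \<bar>f x\<bar> \<le> M"
  shows "(\<integral>x. \<bar>f x\<bar> \<partial>\<mu>) \<le> M * measure \<mu> UNIV"
proof -
  interpret finite_measure \<mu> by fact
  have "(\<integral>x. \<bar>f x\<bar> \<partial>\<mu>) \<le> (\<integral>x. M \<partial>\<mu>)"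
    using assms by (intro integral_mono lipb_integrable) auto
  moreover have "space \<mu> = UNIV" using sets_eq_imp_space_eq[OF assms(2)] by simp
  ultimately show ?thesis by (simp add: mult.commute)
qed

text \<open>Finite mass with an arbitrary Lipschitz constant \<open>C\<close> in place of the
  infimum \<open>lip_const\<close>, so that no optimal constant has to be computed.\<close>

definition mass_bound ::
    "((real^'n \<Rightarrow> real) \<Rightarrow> (real^'n \<Rightarrow> real) \<Rightarrow> real) \<Rightarrow> (real^'n) measure \<Rightarrow> bool" where
  "mass_bound T \<mu> \<longleftrightarrow> finite_measure \<mu> \<and> sets \<mu> = sets borel \<and>
    (\<forall>f \<pi> C. lipb f \<and> C-lipschitz_on UNIV \<pi> \<longrightarrow> \<bar>T f \<pi>\<bar> \<le> C * integral\<^sup>L \<mu> (\<lambda>x. \<bar>f x\<bar>))"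

lemma mass_boundD:
  assumes "mass_bound T \<mu>" "lipb f" "C-lipschitz_on UNIV \<pi>"
  shows "\<bar>T f \<pi>\<bar> \<le> C * integral\<^sup>L \<mu> (\<lambda>x. \<bar>f x\<bar>)"
  using assms by (simp add: mass_bound_def)

lemma metric_current1_mass_bound:
  fixes T :: "(real^'n \<Rightarrow> real) \<Rightarrow> (real^'n \<Rightarrow> real) \<Rightarrow> real"
  assumes "metric_current1 T"
  obtains \<mu> where "mass_bound T \<mu>"
proof -
  obtain \<mu> where m: "finite_measure \<mu>" "sets \<mu> = sets borel" and
    b: "\<And>f \<pi>. lipb f \<Longrightarrow> lipf \<pi> \<Longrightarrow> \<bar>T f \<pi>\<bar> \<le> lip_const \<pi> * integral\<^sup>L \<mu> (\<lambda>x. \<bar>f x\<bar>)"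
  proof -
    have "\<exists>\<mu> :: (real^'n) measure. finite_measure \<mu> \<and> sets \<mu> = sets borel \<and>
        (\<forall>f \<pi>. lipb f \<and> lipf \<pi> \<longrightarrow> \<bar>T f \<pi>\<bar> \<le> lip_const \<pi> * integral\<^sup>L \<mu> (\<lambda>x. \<bar>f x\<bar>))"
      using assms unfolding metric_current1_def by (elim conjE)
    then show ?thesis using that by blast
  qed
  have "\<bar>T f \<pi>\<bar> \<le> C * integral\<^sup>L \<mu> (\<lambda>x. \<bar>f x\<bar>)" if "lipb f" "C-lipschitz_on UNIV \<pi>" for f \<pi> C
  proof -
    have "lip_const \<pi> \<le> C"
      unfolding lip_const_def using that(2)
      by (intro cInf_lower bdd_belowI[of _ 0]) (auto dest: lipschitz_on_nonneg)
    then have "lip_const \<pi> * integral\<^sup>L \<mu> (\<lambda>x. \<bar>f x\<bar>) \<le> C * integral\<^sup>L \<mu> (\<lambda>x. \<bar>f x\<bar>)"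
      by (intro mult_right_mono integral_nonneg) auto
    moreover have "\<bar>T f \<pi>\<bar> \<le> lip_const \<pi> * integral\<^sup>L \<mu> (\<lambda>x. \<bar>f x\<bar>)"
      using that by (intro b) (auto simp: lipf_def)
    ultimately show ?thesis by (rule order_trans[rotated])
  qed
  then have "mass_bound T \<mu>" using m by (simp add: mass_bound_def)
  then show ?thesis by (rule that)
qed

lemma metric_current1_linear1:
  assumes "metric_current1 T" "lipb f" "lipb g" "lipf \<pi>"
  shows "T (\<lambda>x. a * f x + b * g x) \<pi> = a * T f \<pi> + b * T g \<pi>"
proof -
  have "\<forall>f g \<pi> a b. lipb f \<and> lipb g \<and> lipf \<pi> \<longrightarrow>
      T (\<lambda>x. a * f x + b * g x) \<pi> = a * T f \<pi> + b * T g \<pi>"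
    using assms(1) unfolding metric_current1_def by (elim conjE)
  from this[rule_format, of f g \<pi> a b] show ?thesis using assms(2-) by (simp only: simp_thms)
qed

lemma metric_current1_linear2:
  assumes "metric_current1 T" "lipb f" "lipf \<pi>" "lipf \<sigma>"
  shows "T f (\<lambda>x. a * \<pi> x + b * \<sigma> x) = a * T f \<pi> + b * T f \<sigma>"
proof -
  have "\<forall>f \<pi> \<sigma> a b. lipb f \<and> lipf \<pi> \<and> lipf \<sigma> \<longrightarrow>
      T f (\<lambda>x. a * \<pi> x + b * \<sigma> x) = a * T f \<pi> + b * T f \<sigma>"
    using assms(1) unfolding metric_current1_def by (elim conjE)
  from this[rule_format, of f \<pi> \<sigma> a b] show ?thesis using assms(2-) by (simp only: simp_thms)
qed

lemma metric_current1_local: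
  assumes "metric_current1 T" "lipb f" "lipf \<pi>" "open U" "closure {x. f x \<noteq> 0} \<subseteq> U"
    "\<And>x. x \<in> U \<Longrightarrow> \<pi> x = c"
  shows "T f \<pi> = 0"
proof -
  have *: "\<forall>f \<pi>. lipb f \<and> lipf \<pi> \<and> (\<exists>U c. open U \<and> msupp f \<subseteq> U \<and> (\<forall>x\<in>U. \<pi> x = c)) \<longrightarrow> T f \<pi> = 0"
    using assms(1) unfolding metric_current1_def by (elim conjE)
  have "msupp f \<subseteq> U" using assms(5) by (simp add: msupp_def)
  then have "\<exists>U c. open U \<and> msupp f \<subseteq> U \<and> (\<forall>x\<in>U. \<pi> x = c)"
    using assms(4,6) by (intro exI[of _ U] exI[of _ c] conjI ballI)
  with assms(2,3) show ?thesis by (intro *[rule_format] conjI)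
qed

lemma metric_current1_continuous:
  assumes "metric_current1 T" "lipb f" "\<And>n. C-lipschitz_on UNIV (\<pi>s n)"
    "\<And>x. (\<lambda>n. \<pi>s n x) \<longlonglongrightarrow> \<pi> x"
  shows "(\<lambda>n. T f (\<pi>s n)) \<longlonglongrightarrow> T f \<pi>"
proof -
  have "\<forall>f \<pi> \<pi>s C. lipb f \<and> (\<forall>n. C-lipschitz_on UNIV (\<pi>s n)) \<and>
      (\<forall>x. (\<lambda>n. \<pi>s n x) \<longlonglongrightarrow> \<pi> x) \<longrightarrow> (\<lambda>n. T f (\<pi>s n)) \<longlonglongrightarrow> T f \<pi>"
    using assms(1) unfolding metric_current1_def by (elim conjE)
  from this[rule_format, of f C \<pi>s \<pi>] show ?thesis using assms(2-) by (simp only: simp_thms)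
qed

lemma metric_current1_zero1: "metric_current1 T \<Longrightarrow> lipf \<pi> \<Longrightarrow> T (\<lambda>x. 0) \<pi> = 0"
  using metric_current1_linear1[of T "\<lambda>x. 0" "\<lambda>x. 0" \<pi> 0 0] by (simp add: lipb_const)

lemma metric_current1_zero2: "metric_current1 T \<Longrightarrow> lipb f \<Longrightarrow> T f (\<lambda>x. 0) = 0"
  using metric_current1_linear2[of T f "\<lambda>x. 0" "\<lambda>x. 0" 0 0] lipb_lipf[OF lipb_const, of 0] by simp

text \<open>Used with \<open>a\<close> the gradient of \<open>f\<close> at a point, which removes
  the linear part of \<open>f\<close> there. The induction takes one coordinate at a time since
  linearity is available for two summands.\<close>

lemma metric_current1_affine:
  assumes "metric_current1 T" "lipb g" "lipf f" "finite I"
  shows "lipf (\<lambda>x. f x - (\<Sum>i\<in>I. a i * x $ i)) \<and>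
    T g (\<lambda>x. f x - (\<Sum>i\<in>I. a i * x $ i)) = T g f - (\<Sum>i\<in>I. a i * T g (\<lambda>x. x $ i))"
  using assms(4)
proof (induction I rule: finite_induct)
  case (insert i I)
  have eq: "(\<lambda>x. f x - (\<Sum>j\<in>insert i I. a j * x $ j)) =
      (\<lambda>x. 1 * (f x - (\<Sum>j\<in>I. a j * x $ j)) + (- a i) * x $ i)"
    using insert.hyps by auto
  from insert.IH have h: "lipf (\<lambda>x. f x - (\<Sum>j\<in>I. a j * x $ j))"
    and Th: "T g (\<lambda>x. f x - (\<Sum>j\<in>I. a j * x $ j)) = T g f - (\<Sum>j\<in>I. a j * T g (\<lambda>x. x $ j))"
    by auto
  show ?case
    unfolding eq
  proof (intro conjI)
    show "lipf (\<lambda>x. 1 * (f x - (\<Sum>j\<in>I. a j * x $ j)) + (- a i) * x $ i)"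
      by (rule lipf_linear_combination[OF h lipf_coordinate])
    show "T g (\<lambda>x. 1 * (f x - (\<Sum>j\<in>I. a j * x $ j)) + (- a i) * x $ i) =
        T g f - (\<Sum>j\<in>insert i I. a j * T g (\<lambda>x. x $ j))"
      unfolding metric_current1_linear2[OF assms(1,2) h lipf_coordinate] Th
      using insert.hyps by simp
  qed
qed (use assms in simp)

text \<open>Locality lets one replace \<open>\<pi>\<close> by its composition with the nearest-point retraction onto \<open>S\<close>.\<close>

lemma metric_current1_local_mass:
  assumes T: "metric_current1 T" and \<mu>: "mass_bound T \<mu>" and g: "lipb g" and \<pi>: "lipf \<pi>"
    and S: "convex S" "closed S" "C-lipschitz_on S \<pi>"
    and U: "open U" "U \<subseteq> S" "closure {x. g x \<noteq> 0} \<subseteq> U" "U \<noteq> {}"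
  shows "\<bar>T g \<pi>\<bar> \<le> C * integral\<^sup>L \<mu> (\<lambda>x. \<bar>g x\<bar>)"
proof -
  let ?p = "closest_point S"
  have ne: "S \<noteq> {}" using U by blast
  have C0: "0 \<le> C" using S(3) by (rule lipschitz_on_nonneg)
  \<comment> \<open>The nearest-point map of a closed convex set does not increase distances, so the
    Lipschitz constant on \<open>S\<close> becomes a global one.\<close>
  have l: "C-lipschitz_on UNIV (\<lambda>x. \<pi> (?p x))"
  proof (rule lipschitz_onI)
    fix x y
    have "dist (\<pi> (?p x)) (\<pi> (?p y)) \<le> C * dist (?p x) (?p y)"
      using S ne by (intro lipschitz_onD[OF S(3)] closest_point_in_set) auto
    also have "\<dots> \<le> C * dist x y"
      using S ne C0 by (intro mult_left_mono closest_point_lipschitz) auto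
    finally show "dist (\<pi> (?p x)) (\<pi> (?p y)) \<le> C * dist x y" .
  qed (rule C0)
  then have lf: "lipf (\<lambda>x. \<pi> (?p x))" unfolding lipf_def by blast
  have "T g (\<lambda>x. 1 * \<pi> x + (-1) * \<pi> (?p x)) = 0"
    by (rule metric_current1_local[OF T g lipf_linear_combination[OF \<pi> lf] U(1,3), where c = 0])
      (use U(2) in \<open>auto simp: closest_point_self\<close>)
  then have "T g \<pi> = T g (\<lambda>x. \<pi> (?p x))"
    unfolding metric_current1_linear2[OF T g \<pi> lf] by simp
  then show ?thesis using mass_boundD[OF \<mu> g l] by simp
qed

lemma cutoff_exists:
  fixes z :: "real^'n"
  assumes "0 < \<rho>"
  obtains c where "lipb c" "\<And>x. 0 \<le> c x" "\<And>x. c x \<le> 1" "\<And>x. x \<in> ball z \<rho> \<Longrightarrow> c x = 1"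
    "\<And>x. x \<notin> cball z (2 * \<rho>) \<Longrightarrow> c x = 0"
proof
  \<comment> \<open>Truncation to values in [0, 1] gives 1 up to distance \<open>\<rho>\<close> and
    0 from distance \<open>2 * \<rho>\<close> on, with slope \<open>1 / \<rho>\<close> in
    between.\<close>
  let ?c = "\<lambda>x. max 0 (min 1 (2 - dist z x / \<rho>))"
  have "(1 / \<rho>)-lipschitz_on UNIV ?c"
  proof (rule lipschitz_onI)
    fix x y
    have "\<bar>?c x - ?c y\<bar> \<le> \<bar>dist z x / \<rho> - dist z y / \<rho>\<bar>" by linarith
    also have "\<dots> = \<bar>dist z x - dist z y\<bar> / \<rho>" using assms by (simp add: diff_divide_distrib[symmetric])
    also have "\<dots> \<le> dist x y / \<rho>"
      using assms abs_dist_diff_le[of x z y] by (simp add: divide_right_mono dist_commute)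
    finally show "dist (?c x) (?c y) \<le> 1 / \<rho> * dist x y" by (simp add: dist_real_def)
  qed (use assms in simp)
  then show "lipb ?c" by (rule lipbI[where M = 1]) auto
  show "?c x = 1" if "x \<in> ball z \<rho>" for x
  proof -
    have "dist z x / \<rho> \<le> 1" using that assms by simp
    then show ?thesis by linarith
  qed
  show "?c x = 0" if "x \<notin> cball z (2 * \<rho>)" for x
  proof -
    have "dist z x / \<rho> \<ge> 2" using that assms by (simp add: field_simps)
    then show ?thesis by linarith
  qed
qed auto

section \<open>The chain rule for C_c^2 functions\<close>

definition chain_defect ::
    "((real^'n \<Rightarrow> real) \<Rightarrow> (real^'n \<Rightarrow> real) \<Rightarrow> real) \<Rightarrow> (real^'n \<Rightarrow> real) \<Rightarrow> (real^'n \<Rightarrow> real) \<Rightarrow> real" where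
  "chain_defect T f g = T g f - (\<Sum>i\<in>UNIV. T (\<lambda>x. g x * pd i f x) (\<lambda>x. x $ i))"

text \<open>Linearity in \<open>g\<close> allows the constant function 1 to be cut into pieces of
  small support; the chain rule is the vanishing of the defect at \<open>g = 1\<close>.\<close>

lemma chain_defect_linear:
  assumes T: "metric_current1 T" and f: "cc2 f" and g: "lipb g" and h: "lipb h"
  shows "chain_defect T f (\<lambda>x. a * g x + b * h x) = a * chain_defect T f g + b * chain_defect T f h"
proof -
  have p: "lipb (pd i f)" for i using f by (simp add: cc2_def cc1_lipb)
  have lf: "lipf f" using f by (simp add: cc2_def cc1_lipb lipb_lipf)
  have "T (\<lambda>x. (a * g x + b * h x) * pd i f x) (\<lambda>x. x $ i) =
      a * T (\<lambda>x. g x * pd i f x) (\<lambda>x. x $ i) + b * T (\<lambda>x. h x * pd i f x) (\<lambda>x. x $ i)" for i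
    using metric_current1_linear1[OF T lipb_mult[OF g p] lipb_mult[OF h p] lipf_coordinate, of a i b i]
    by (simp add: algebra_simps)
  then show ?thesis
    unfolding chain_defect_def
    by (simp add: metric_current1_linear1[OF T g h lf] sum.distrib sum_distrib_left algebra_simps)
qed

text \<open>The gradient is frozen at the centre \<open>z\<close>, with value \<open>a\<close>. The
  defect then splits into \<open>T g r\<close>, where \<open>r\<close> is \<open>f\<close> minus its
  linear part at \<open>z\<close>, and the error of replacing each \<open>pd i f\<close> by
  \<open>a i\<close>. Both are of order \<open>\<rho>\<close> relative to the integral of
  \<open>\<bar>g\<bar>\<close>.\<close>

lemma chain_defect_local_bound:
  fixes f :: "real^'n \<Rightarrow> real"
  assumes T: "metric_current1 T" and \<mu>: "mass_bound T \<mu>" and f: "cc2 f" and g: "lipb g"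
    and L: "\<And>i. L-lipschitz_on UNIV (pd i f)" and \<rho>: "0 < \<rho>"
    and supp: "\<And>x. x \<notin> cball z (2 * \<rho>) \<Longrightarrow> g x = 0"
  shows "\<bar>chain_defect T f g\<bar> \<le>
    (3 * L * CARD('n) * CARD('n) + 2 * L * CARD('n)) * \<rho> * integral\<^sup>L \<mu> (\<lambda>x. \<bar>g x\<bar>)"
proof -
  define d where "d = real CARD('n)"
  define J where "J = integral\<^sup>L \<mu> (\<lambda>x. \<bar>g x\<bar>)"
  have L0: "0 \<le> L" using L lipschitz_on_nonneg by blast
  have p: "lipb (pd i f)" for i using f by (simp add: cc2_def cc1_lipb)
  have lf: "lipf f" and hf: "has_pds f" using f by (simp_all add: cc2_def cc1_def cc1_lipb lipb_lipf)
  have J0: "0 \<le> J" by (simp add: J_def)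
  have pdL: "\<bar>pd i f x - pd i f z\<bar> \<le> L * norm (x - z)" for i x
    using lipschitz_onD[OF L, of x z i] by (simp add: dist_norm)
  define a where "a i = pd i f z" for i
  define r where "r = (\<lambda>x. f x - (\<Sum>i\<in>UNIV. a i * x $ i))"
  \<comment> \<open>A box, as the Lipschitz estimate from partial derivatives asks for an interval.
    It contains \<open>ball z (3 * \<rho>)\<close>, and the gap between \<open>2 * \<rho>\<close>
    and \<open>3 * \<rho>\<close> makes this ball an open neighbourhood of the support of
    \<open>g\<close>.\<close>
  define S where "S = cbox (z - (\<chi> i. 3 * \<rho>)) (z + (\<chi> i. 3 * \<rho>))"
  have S: "\<bar>x $ i - z $ i\<bar> \<le> 3 * \<rho>" if "x \<in> S" for x i
    using that by (auto simp: S_def mem_box_cart abs_le_iff algebra_simps dest!: spec[of _ i])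
  have r: "lipf r" "T g r = T g f - (\<Sum>i\<in>UNIV. a i * T g (\<lambda>x. x $ i))"
    unfolding r_def using metric_current1_affine[OF T g lf, of UNIV a] by auto
  have dr: "((\<lambda>t. r (x + t *\<^sub>R axis i 1)) has_real_derivative pd i f x - a i) (at 0)" for i x
  proof -
    have "r (x + t *\<^sub>R axis i 1) =
        f (x + t *\<^sub>R axis i 1) - ((\<Sum>j\<in>UNIV. a j * x $ j) + a i * t)" for t
    proof -
      have "(\<Sum>j\<in>UNIV. a j * (x + t *\<^sub>R axis i 1) $ j) =
          (\<Sum>j\<in>UNIV. a j * x $ j + (if j = i then a i * t else 0))"
        by (intro sum.cong) (auto simp: axis_def algebra_simps)
      then show ?thesis by (simp add: r_def sum.distrib)
    qed
    moreover have "((\<lambda>t. f (x + t *\<^sub>R axis i 1) - ((\<Sum>j\<in>UNIV. a j * x $ j) + a i * t))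
        has_real_derivative pd i f x - (0 + a i * 1)) (at 0)"
      using hf unfolding has_pds_def
      by (intro DERIV_diff DERIV_add DERIV_const DERIV_cmult DERIV_ident) auto
    ultimately show ?thesis by simp
  qed
  have pr: "pd i r x = pd i f x - a i" for i x using dr by (rule pd_eqI)
  have hr: "has_pds r" using dr unfolding has_pds_def pr by blast
  \<comment> \<open>On \<open>S\<close> the distance to \<open>z\<close> is at most
    \<open>3 * \<rho> * d\<close>, and the partial derivatives of \<open>r\<close> vanish at
    \<open>z\<close>. Passing from them to a Lipschitz constant costs the second dimension
    factor.\<close>
  have "(L * (3 * \<rho> * d) * CARD('n))-lipschitz_on S r"
  proof (rule lipschitz_on_of_pd_bound[OF hr])
    show "is_interval S" by (simp add: S_def is_interval_cbox)
    show "0 \<le> L * (3 * \<rho> * d)" using L0 \<rho> by (simp add: d_def)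
    fix i x assume x: "x \<in> S"
    have "norm (x - z) \<le> (\<Sum>j\<in>UNIV. \<bar>(x - z) $ j\<bar>)" by (rule norm_le_l1_cart)
    also have "\<dots> \<le> of_nat CARD('n) * (3 * \<rho>)"
      using S[OF x] by (intro sum_bounded_above) auto
    finally have "norm (x - z) \<le> 3 * \<rho> * d" by (simp add: d_def mult.commute)
    then have "L * norm (x - z) \<le> L * (3 * \<rho> * d)" using L0 by (rule mult_left_mono)
    then show "\<bar>pd i r x\<bar> \<le> L * (3 * \<rho> * d)"
      using pdL[of i x] by (simp add: pr a_def)
  qed
  moreover have "ball z (3 * \<rho>) \<subseteq> S"
  proof
    fix x assume "x \<in> ball z (3 * \<rho>)"
    then have "norm (x - z) < 3 * \<rho>" by (simp add: dist_norm norm_minus_commute)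
    then have "\<bar>(x - z) $ i\<bar> \<le> 3 * \<rho>" for i
      using component_le_norm_cart[of "x - z" i] by linarith
    then show "x \<in> S" by (auto simp: S_def mem_box_cart abs_le_iff algebra_simps)
  qed
  moreover have "closure {x. g x \<noteq> 0} \<subseteq> ball z (3 * \<rho>)"
  proof -
    have "closure {x. g x \<noteq> 0} \<subseteq> cball z (2 * \<rho>)"
      using supp by (intro closure_minimal) (blast, simp)
    also have "\<dots> \<subseteq> ball z (3 * \<rho>)" using \<rho> by auto
    finally show ?thesis .
  qed
  ultimately have 1: "\<bar>T g r\<bar> \<le> L * (3 * \<rho> * d) * d * J"
    unfolding J_def d_def using \<rho>
    by (intro metric_current1_local_mass[OF T \<mu> g r(1), of S _ "ball z (3 * \<rho>)"])
      (simp_all add: S_def closed_cbox)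
  \<comment> \<open>Coordinates are 1-Lipschitz, and where \<open>g\<close> is nonzero
    \<open>pd i f\<close> differs from \<open>a i\<close> by at most
    \<open>L * (2 * \<rho>)\<close>.\<close>
  have 2: "\<bar>T (\<lambda>x. g x * pd i f x) (\<lambda>x. x $ i) - a i * T g (\<lambda>x. x $ i)\<bar> \<le> L * (2 * \<rho>) * J" for i
  proof -
    define h where "h = (\<lambda>x. 1 * (g x * pd i f x) + (- a i) * g x)"
    have h: "lipb h" unfolding h_def by (intro lipb_linear_combination lipb_mult g p)
    have fm: "finite_measure \<mu>" "sets \<mu> = sets borel" using \<mu> by (auto simp: mass_bound_def)
    have "T h (\<lambda>x. x $ i) = T (\<lambda>x. g x * pd i f x) (\<lambda>x. x $ i) - a i * T g (\<lambda>x. x $ i)"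
      unfolding h_def metric_current1_linear1[OF T lipb_mult[OF g p] g lipf_coordinate] by simp
    moreover have "\<bar>T h (\<lambda>x. x $ i)\<bar> \<le> 1 * integral\<^sup>L \<mu> (\<lambda>x. \<bar>h x\<bar>)"
      by (rule mass_boundD[OF \<mu> h lipschitz_coordinate])
    moreover have "integral\<^sup>L \<mu> (\<lambda>x. \<bar>h x\<bar>) \<le> integral\<^sup>L \<mu> (\<lambda>x. L * (2 * \<rho>) * \<bar>g x\<bar>)"
    proof (rule integral_mono)
      show "\<bar>h x\<bar> \<le> L * (2 * \<rho>) * \<bar>g x\<bar>" for x
      proof (cases "x \<in> cball z (2 * \<rho>)")
        case True
        then have "L * norm (x - z) \<le> L * (2 * \<rho>)"
          using L0 by (intro mult_left_mono) (auto simp: dist_norm norm_minus_commute)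
        then have "\<bar>pd i f x - a i\<bar> * \<bar>g x\<bar> \<le> L * (2 * \<rho>) * \<bar>g x\<bar>"
          using pdL[of i x] unfolding a_def by (intro mult_right_mono) auto
        moreover have "h x = (pd i f x - a i) * g x" by (simp add: h_def algebra_simps)
        ultimately show ?thesis by (simp add: abs_mult)
      qed (simp add: h_def supp)
    qed (use lipb_integrable[OF fm] h g in auto)
    ultimately show ?thesis by (simp add: J_def)
  qed
  have "chain_defect T f g = T g r -
      (\<Sum>i\<in>UNIV. T (\<lambda>x. g x * pd i f x) (\<lambda>x. x $ i) - a i * T g (\<lambda>x. x $ i))"
    by (simp add: chain_defect_def r sum_subtractf)
  also have "\<bar>\<dots>\<bar> \<le> \<bar>T g r\<bar> +
      (\<Sum>i\<in>UNIV. \<bar>T (\<lambda>x. g x * pd i f x) (\<lambda>x. x $ i) - a i * T g (\<lambda>x. x $ i)\<bar>)"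
    by (rule order_trans[OF abs_triangle_ineq4]) (intro add_mono sum_abs order_refl)
  also have "\<dots> \<le> L * (3 * \<rho> * d) * d * J + of_nat CARD('n) * (L * (2 * \<rho>) * J)"
    by (intro add_mono 1 sum_bounded_above 2)
  finally show ?thesis by (simp add: d_def J_def algebra_simps)
qed

text \<open>The balls are peeled off one by one: a cutoff at \<open>z\<close> splits
  \<open>g\<close> into a piece supported near \<open>z\<close> and a rest vanishing on
  \<open>ball z \<rho>\<close>. Since
  \<open>\<bar>g1\<bar> + \<bar>g2\<bar> = \<bar>g\<bar>\<close>, the bounds add up exactly and
  \<open>K\<close> does not grow with the number of balls.\<close>

lemma chain_defect_bound:
  fixes f :: "real^'n \<Rightarrow> real"
  assumes T: "metric_current1 T" and \<mu>: "mass_bound T \<mu>" and f: "cc2 f"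
    and R: "\<And>x. norm x > R \<Longrightarrow> f x = 0"
    and loc: "\<And>g z. lipb g \<Longrightarrow> (\<And>x. x \<notin> cball z (2 * \<rho>) \<Longrightarrow> g x = 0) \<Longrightarrow>
      \<bar>chain_defect T f g\<bar> \<le> K * integral\<^sup>L \<mu> (\<lambda>x. \<bar>g x\<bar>)"
    and K: "0 \<le> K" and \<rho>: "0 < \<rho>" and "finite X" and g: "lipb g"
    and "\<And>x. norm x \<le> R + 1 \<Longrightarrow> x \<notin> (\<Union>z\<in>X. ball z \<rho>) \<Longrightarrow> g x = 0"
  shows "\<bar>chain_defect T f g\<bar> \<le> K * integral\<^sup>L \<mu> (\<lambda>x. \<bar>g x\<bar>)"
  using assms(8-)
proof (induction X arbitrary: g rule: finite_induct)
  case empty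
  have lf: "lipf f" using f by (simp add: cc2_def cc1_lipb lipb_lipf)
  \<comment> \<open>The margin 1 in \<open>R + 1\<close> leaves room for an open set around the
    support of \<open>g\<close> on which \<open>f\<close> vanishes, as locality demands.\<close>
  have "T g f = 0"
  proof (rule metric_current1_local[OF T empty(1) lf, where c = 0])
    have "closure {x. g x \<noteq> 0} \<subseteq> {x. norm x \<ge> R + 1}"
      using empty(2) by (intro closure_minimal closed_Collect_le continuous_intros) force
    also have "\<dots> \<subseteq> {x. norm x > R}" by auto
    finally show "closure {x. g x \<noteq> 0} \<subseteq> {x. norm x > R}" .
    show "open {x::real^'n. norm x > R}" by (intro open_Collect_less continuous_intros)
  qed (use R in auto)
  moreover have "(\<lambda>x. g x * pd i f x) = (\<lambda>x. 0)" for i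
  proof
    show "g x * pd i f x = 0" for x
      using empty(2)[of x] pd_zero_outside[of R f x i] R by (cases "norm x > R") auto
  qed
  ultimately have "chain_defect T f g = 0"
    by (simp add: chain_defect_def metric_current1_zero1[OF T lipf_coordinate])
  then show ?case using K by simp
next
  case (insert z X)
  have fm: "finite_measure \<mu>" "sets \<mu> = sets borel" using \<mu> by (auto simp: mass_bound_def)
  obtain c where c: "lipb c" "\<And>x. 0 \<le> c x" "\<And>x. c x \<le> 1" "\<And>x. x \<in> ball z \<rho> \<Longrightarrow> c x = 1"
    "\<And>x. x \<notin> cball z (2 * \<rho>) \<Longrightarrow> c x = 0"
    using cutoff_exists[OF \<rho>] by blast
  define g1 where "g1 = (\<lambda>x. g x * c x)"
  define g2 where "g2 = (\<lambda>x. 1 * g x + (-1) * g1 x)"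
  have l1: "lipb g1" unfolding g1_def by (intro lipb_mult insert.prems c)
  have l2: "lipb g2" unfolding g2_def by (intro lipb_linear_combination insert.prems l1)
  have g2: "g2 x = g x * (1 - c x)" for x by (simp add: g2_def g1_def algebra_simps)
  have "\<bar>chain_defect T f g1\<bar> \<le> K * integral\<^sup>L \<mu> (\<lambda>x. \<bar>g1 x\<bar>)"
    by (rule loc[OF l1, of z]) (simp add: g1_def c)
  moreover have "\<bar>chain_defect T f g2\<bar> \<le> K * integral\<^sup>L \<mu> (\<lambda>x. \<bar>g2 x\<bar>)"
  proof (rule insert.IH[OF l2])
    show "g2 x = 0" if "norm x \<le> R + 1" "x \<notin> (\<Union>z\<in>X. ball z \<rho>)" for x
      using insert.prems(2)[of x] c(4)[of x] that unfolding g2 by (cases "x \<in> ball z \<rho>") auto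
  qed
  moreover have "g = (\<lambda>x. 1 * g1 x + 1 * g2 x)" by (simp add: g2_def)
  then have "chain_defect T f g = 1 * chain_defect T f g1 + 1 * chain_defect T f g2"
    using chain_defect_linear[OF T f l1 l2] by metis
  moreover have "integral\<^sup>L \<mu> (\<lambda>x. \<bar>g1 x\<bar>) + integral\<^sup>L \<mu> (\<lambda>x. \<bar>g2 x\<bar>) = integral\<^sup>L \<mu> (\<lambda>x. \<bar>g x\<bar>)"
  proof -
    have "\<bar>g1 x\<bar> + \<bar>g2 x\<bar> = \<bar>g x\<bar>" for x
    proof -
      have "\<bar>g1 x\<bar> = \<bar>g x\<bar> * c x" "\<bar>g2 x\<bar> = \<bar>g x\<bar> * (1 - c x)"
        using c(2)[of x] c(3)[of x] by (simp_all add: g1_def g2 abs_mult)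
      then show ?thesis by (simp add: algebra_simps)
    qed
    then show ?thesis
      by (simp add: Bochner_Integration.integral_add[symmetric] lipb_integrable[OF fm] l1 l2)
  qed
  then have "K * integral\<^sup>L \<mu> (\<lambda>x. \<bar>g1 x\<bar>) + K * integral\<^sup>L \<mu> (\<lambda>x. \<bar>g2 x\<bar>) = K * integral\<^sup>L \<mu> (\<lambda>x. \<bar>g x\<bar>)"
    by (metis distrib_left)
  ultimately show ?case by linarith
qed

text \<open>Covering the ball of radius \<open>R + 1\<close> by finitely many balls of radius
  \<open>\<rho>\<close> bounds the defect at \<open>g = 1\<close> by \<open>K * \<rho> * J\<close>,
  with \<open>K\<close> and \<open>J\<close> independent of \<open>\<rho>\<close>; then
  \<open>\<rho>\<close> tends to 0.\<close>

lemma metric_current1_chain_rule: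
  fixes f :: "real^'n \<Rightarrow> real"
  assumes T: "metric_current1 T" and f: "cc2 f"
  shows "T (\<lambda>x. 1) f = (\<Sum>i\<in>UNIV. T (pd i f) (\<lambda>x. x $ i))"
proof -
  obtain \<mu> where \<mu>: "mass_bound T \<mu>" using metric_current1_mass_bound[OF T] by blast
  obtain R where R: "\<And>x. norm x > R \<Longrightarrow> f x = 0" using f unfolding cc2_def cc1_def cc_def by blast
  have "\<forall>i. \<exists>L\<ge>0. L-lipschitz_on UNIV (pd i f)"
  proof
    fix i
    have "lipf (pd i f)" using f by (simp add: cc2_def cc1_lipb lipb_lipf)
    then show "\<exists>L\<ge>0. L-lipschitz_on UNIV (pd i f)" using lipf_lipschitz by blast
  qed
  then obtain Li where Li: "\<And>i. 0 \<le> Li i" "\<And>i. (Li i)-lipschitz_on UNIV (pd i f)" by metis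
  define L where "L = (\<Sum>i\<in>UNIV. Li i)"
  have L: "L-lipschitz_on UNIV (pd i f)" for i
    using Li(2)[of i] by (rule lipschitz_on_mono) (auto simp: L_def intro!: member_le_sum Li)
  have L0: "0 \<le> L" using L lipschitz_on_nonneg by blast
  define K where "K = 3 * L * CARD('n) * CARD('n) + 2 * L * CARD('n)"
  define J where "J = integral\<^sup>L \<mu> (\<lambda>x::real^'n. \<bar>1::real\<bar>)"
  have K0: "0 \<le> K" by (simp add: K_def L0)
  have b: "\<bar>chain_defect T f (\<lambda>x. 1)\<bar> \<le> K * \<rho> * J" if \<rho>: "0 < \<rho>" for \<rho>
  proof -
    have cover: "cball (0::real^'n) (R + 1) \<subseteq> (\<Union>z\<in>cball 0 (R + 1). ball z \<rho>)"
    proof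
      fix x :: "real^'n" assume "x \<in> cball 0 (R + 1)"
      moreover have "x \<in> ball x \<rho>" using \<rho> by simp
      ultimately show "x \<in> (\<Union>z\<in>cball 0 (R + 1). ball z \<rho>)" by blast
    qed
    obtain X where X: "X \<subseteq> cball 0 (R + 1)" "finite X"
      "cball (0::real^'n) (R + 1) \<subseteq> (\<Union>z\<in>X. ball z \<rho>)"
      by (rule compactE_image[OF compact_cball _ cover]) (rule open_ball)
    show ?thesis unfolding J_def
    proof (rule chain_defect_bound[OF T \<mu> f R _ _ \<rho> X(2) lipb_const])
      show "0 \<le> K * \<rho>" using K0 \<rho> by simp
      show "\<bar>chain_defect T f g\<bar> \<le> K * \<rho> * integral\<^sup>L \<mu> (\<lambda>x. \<bar>g x\<bar>)"
        if "lipb g" "\<And>x. x \<notin> cball z (2 * \<rho>) \<Longrightarrow> g x = 0" for g z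
        unfolding K_def by (rule chain_defect_local_bound[OF T \<mu> f that(1) L \<rho> that(2)])
      show "(1::real) = 0" if "norm x \<le> R + 1" "x \<notin> (\<Union>z\<in>X. ball z \<rho>)" for x
        using X(3) that by (meson mem_cball_0 subsetD)
    qed
  qed
  have "((\<lambda>\<rho>. K * \<rho> * J) \<longlongrightarrow> K * 0 * J) (at_right 0)" by (intro tendsto_intros)
  then have "\<bar>chain_defect T f (\<lambda>x. 1)\<bar> \<le> K * 0 * J"
    by (rule tendsto_lowerbound) (auto intro: eventually_mono[OF eventually_at_right_less b])
  then show ?thesis by (simp add: chain_defect_def)
qed

section \<open>Normal approximations\<close>

text \<open>The operator \<open>\<Phi>\<close> acts on the coefficients before \<open>T\<close>. The
  identity gives the induced current and \<open>means\<close> its approximations, so linearity,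
  bounds and continuity are proved once for both.\<close>

definition coord_functional ::
    "((real^'n \<Rightarrow> real) \<Rightarrow> (real^'n \<Rightarrow> real) \<Rightarrow> real) \<Rightarrow>
      ((real^'n \<Rightarrow> real) \<Rightarrow> real^'n \<Rightarrow> real) \<Rightarrow> (real^'n \<Rightarrow> real^'n) \<Rightarrow> real" where
  "coord_functional T \<Phi> \<omega> = (\<Sum>i\<in>UNIV. T (\<Phi> (\<lambda>x. \<omega> x $ i)) (\<lambda>x. x $ i))"

definition contraction_op :: "((real^'n \<Rightarrow> real) \<Rightarrow> real^'n \<Rightarrow> real) \<Rightarrow> bool" where
  "contraction_op \<Phi> \<longleftrightarrow>
    (\<forall>f g a b. cc1 f \<and> cc1 g \<longrightarrow> \<Phi> (\<lambda>x. a * f x + b * g x) = (\<lambda>x. a * \<Phi> f x + b * \<Phi> g x)) \<and>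
    (\<forall>g. cc1 g \<longrightarrow> lipb (\<Phi> g)) \<and>
    (\<forall>g M x. cc1 g \<and> (\<forall>y. \<bar>g y\<bar> \<le> M) \<longrightarrow> \<bar>\<Phi> g x\<bar> \<le> M)"

lemma contraction_op_id: "contraction_op (\<lambda>g. g)"
  by (simp add: contraction_op_def cc1_lipb)

lemma contraction_op_means: "0 < \<epsilon> \<Longrightarrow> contraction_op (means \<epsilon> ks)"
  unfolding contraction_op_def
  by (intro conjI allI impI means_linear_combination cc1_lipb means_cc1 means_bound) auto

lemma coord_functional_linear:
  assumes T: "metric_current1 T" and \<Phi>: "contraction_op \<Phi>"
    and c: "\<And>i. cc1 (\<lambda>x. \<omega> x $ i)" "\<And>i. cc1 (\<lambda>x. \<eta> x $ i)"
  shows "coord_functional T \<Phi> (\<lambda>x. a *\<^sub>R \<omega> x + b *\<^sub>R \<eta> x) =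
    a * coord_functional T \<Phi> \<omega> + b * coord_functional T \<Phi> \<eta>"
proof -
  have "\<Phi> (\<lambda>x. a * \<omega> x $ i + b * \<eta> x $ i) =
      (\<lambda>x. a * \<Phi> (\<lambda>x. \<omega> x $ i) x + b * \<Phi> (\<lambda>x. \<eta> x $ i) x)" for i
    using \<Phi> c unfolding contraction_op_def by blast
  moreover have "lipb (\<Phi> (\<lambda>x. \<omega> x $ i))" "lipb (\<Phi> (\<lambda>x. \<eta> x $ i))" for i
    using \<Phi> c unfolding contraction_op_def by blast+
  ultimately show ?thesis
    by (simp add: coord_functional_def metric_current1_linear1[OF T _ _ lipf_coordinate]
        sum.distrib sum_distrib_left)
qed

lemma sum_coordinates_bound:
  fixes h :: "'n::finite \<Rightarrow> real^'n \<Rightarrow> real"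
  assumes \<mu>: "mass_bound T \<mu>" and h: "\<And>i. lipb (h i)" "\<And>i x. \<bar>h i x\<bar> \<le> M"
  shows "\<bar>\<Sum>i\<in>UNIV. T (h i) (\<lambda>x. x $ i)\<bar> \<le> CARD('n) * (M * measure \<mu> UNIV)"
proof -
  have fm: "finite_measure \<mu>" "sets \<mu> = sets borel" using \<mu> by (auto simp: mass_bound_def)
  have "\<bar>T (h i) (\<lambda>x. x $ i)\<bar> \<le> M * measure \<mu> UNIV" for i
  proof -
    have "\<bar>T (h i) (\<lambda>x. x $ i)\<bar> \<le> 1 * integral\<^sup>L \<mu> (\<lambda>x. \<bar>h i x\<bar>)"
      by (rule mass_boundD[OF \<mu> h(1) lipschitz_coordinate])
    then show ?thesis using lipb_integral_le[OF fm h, of i] by simp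
  qed
  then have "(\<Sum>i\<in>UNIV. \<bar>T (h i) (\<lambda>x. x $ i)\<bar>) \<le> of_nat CARD('n) * (M * measure \<mu> UNIV)"
    by (intro sum_bounded_above)
  then show ?thesis by (rule order_trans[OF sum_abs])
qed

lemma coord_functional_bound:
  fixes \<omega> :: "real^'n \<Rightarrow> real^'n"
  assumes \<mu>: "mass_bound T \<mu>" and \<Phi>: "contraction_op \<Phi>"
    and c: "\<And>i. cc1 (\<lambda>x. \<omega> x $ i)" "\<And>i x. \<bar>\<omega> x $ i\<bar> \<le> M"
  shows "\<bar>coord_functional T \<Phi> \<omega>\<bar> \<le> CARD('n) * (M * measure \<mu> UNIV)"
  unfolding coord_functional_def
proof (rule sum_coordinates_bound[OF \<mu>])
  show "lipb (\<Phi> (\<lambda>x. \<omega> x $ i))" for i using \<Phi> c unfolding contraction_op_def by blast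
  show "\<bar>\<Phi> (\<lambda>x. \<omega> x $ i) x\<bar> \<le> M" for i x using \<Phi> c unfolding contraction_op_def by blast
qed

lemma test1_cc2: "test1 \<omega> \<Longrightarrow> cc2 (\<lambda>x. \<omega> x $ i)"
  by (simp add: test1_def test0_cc2)

lemma test1_cc1: "test1 \<omega> \<Longrightarrow> cc1 (\<lambda>x. \<omega> x $ i)"
  using test1_cc2 unfolding cc2_def by blast

text \<open>Convergence of test forms includes, for the empty index list, uniform convergence of the
  coefficients, and the functional is bounded in the sup norm by finite mass.\<close>

lemma coord_functional_current1:
  fixes T :: "(real^'n \<Rightarrow> real) \<Rightarrow> (real^'n \<Rightarrow> real) \<Rightarrow> real"
  assumes T: "metric_current1 T" and \<Phi>: "contraction_op \<Phi>"
  shows "current1 (coord_functional T \<Phi>)"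
proof -
  let ?S = "coord_functional T \<Phi>"
  obtain \<mu> where \<mu>: "mass_bound T \<mu>" using metric_current1_mass_bound[OF T] by blast
  define D where "D = CARD('n) * measure \<mu> UNIV"
  have D0: "0 \<le> D" by (simp add: D_def)
  have cont: "(\<lambda>k. ?S (\<omega>s k)) \<longlonglongrightarrow> ?S \<omega>"
    if t: "\<And>k. test1 (\<omega>s k)" "test1 \<omega>" and conv: "D_conv \<omega>s \<omega>" for \<omega>s \<omega>
  proof (rule tendstoI)
    fix e :: real assume e: "0 < e"
    \<comment> \<open>The summand 1 keeps the denominator positive when
      \<open>D = 0\<close>.\<close>
    define r where "r = e / (D + 1)"
    have r: "0 < r" "D * r < e" using e D0 by (auto simp: r_def field_simps)
    have "uniform_limit UNIV (\<lambda>k y. \<omega>s k y $ j) (\<lambda>y. \<omega> y $ j) sequentially" for j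
      using conv[unfolded D_conv_def, THEN conjunct2, rule_format, of "[]" j] by simp
    then have "\<forall>\<^sub>F k in sequentially. \<forall>j. \<forall>x. dist (\<omega>s k x $ j) (\<omega> x $ j) < r"
      using r by (intro eventually_all_finite) (simp add: uniform_limit_iff)
    then show "\<forall>\<^sub>F k in sequentially. dist (?S (\<omega>s k)) (?S \<omega>) < e"
    proof eventually_elim
      case (elim k)
      let ?d = "\<lambda>x. 1 *\<^sub>R \<omega>s k x + (-1) *\<^sub>R \<omega> x"
      have c: "cc1 (\<lambda>x. ?d x $ i)" for i
        using cc1_linear_combination[OF test1_cc1[OF t(1)] test1_cc1[OF t(2)], of 1 k i "-1" i] by simp
      have "\<bar>?d x $ i\<bar> \<le> r" for i x
        using elim[rule_format, of x i] by (simp add: dist_real_def)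
      then have "\<bar>?S ?d\<bar> \<le> CARD('n) * (r * measure \<mu> UNIV)"
        by (rule coord_functional_bound[OF \<mu> \<Phi> c])
      also have "\<dots> = D * r" by (simp add: D_def)
      finally have "\<bar>?S ?d\<bar> < e" using r by simp
      then show ?case
        unfolding coord_functional_linear[OF T \<Phi> test1_cc1[OF t(1)] test1_cc1[OF t(2)]]
        by (simp add: dist_real_def)
    qed
  qed
  have lin: "?S (\<lambda>x. a *\<^sub>R \<omega> x + b *\<^sub>R \<eta> x) = a * ?S \<omega> + b * ?S \<eta>"
    if "test1 \<omega>" "test1 \<eta>" for \<omega> \<eta> a b
    by (rule coord_functional_linear[OF T \<Phi> test1_cc1[OF that(1)] test1_cc1[OF that(2)]])
  show ?thesis
    unfolding current1_def
  proof (intro conjI allI impI)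
    fix \<omega> \<eta> :: "real^'n \<Rightarrow> real^'n" and a b :: real
    assume "test1 \<omega> \<and> test1 \<eta>"
    then show "?S (\<lambda>x. a *\<^sub>R \<omega> x + b *\<^sub>R \<eta> x) = a * ?S \<omega> + b * ?S \<eta>"
      by (elim conjE) (rule lin)
  next
    fix \<omega>s :: "nat \<Rightarrow> real^'n \<Rightarrow> real^'n" and \<omega>
    assume "(\<forall>k. test1 (\<omega>s k)) \<and> test1 \<omega> \<and> D_conv \<omega>s \<omega>"
    then show "(\<lambda>k. ?S (\<omega>s k)) \<longlonglongrightarrow> ?S \<omega>"
      by (intro cont) auto
  qed
qed

text \<open>On \<open>dfun \<phi>\<close> the functional sees only averaged derivatives of
  \<open>\<phi>\<close>. As \<open>ks\<close> contains every direction, each of them is bounded by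
  \<open>2 / \<epsilon>\<close>, which controls the boundary mass.\<close>

lemma means_normal1:
  fixes T :: "(real^'n \<Rightarrow> real) \<Rightarrow> (real^'n \<Rightarrow> real) \<Rightarrow> real"
  assumes T: "metric_current1 T" and \<epsilon>: "0 < \<epsilon>" and ks: "set ks = UNIV"
  shows "normal1 (coord_functional T (means \<epsilon> ks))"
proof -
  let ?S = "coord_functional T (means \<epsilon> ks)"
  obtain \<mu> where \<mu>: "mass_bound T \<mu>" using metric_current1_mass_bound[OF T] by blast
  note \<Phi> = contraction_op_means[OF \<epsilon>]
  define D where "D = CARD('n) * measure \<mu> UNIV"
  have m: "mass1 ?S \<le> ereal D"
    unfolding mass1_def
  proof (rule SUP_least)
    fix \<omega> :: "real^'n \<Rightarrow> real^'n"
    assume w: "\<omega> \<in> {\<omega>. test1 \<omega> \<and> (\<forall>x. norm (\<omega> x) \<le> 1)}"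
    then have nb: "norm (\<omega> x) \<le> 1" for x by simp
    have "\<bar>\<omega> x $ i\<bar> \<le> 1" for x i
      using component_le_norm_cart[of "\<omega> x" i] nb[of x] by linarith
    then have "\<bar>?S \<omega>\<bar> \<le> CARD('n) * (1 * measure \<mu> UNIV)"
      using w by (intro coord_functional_bound[OF \<mu> \<Phi>] test1_cc1) auto
    then show "ereal (?S \<omega>) \<le> ereal D" by (simp add: D_def)
  qed
  have bm: "bdry_mass1 ?S \<le> ereal (CARD('n) * (2 * 1 / \<epsilon> * measure \<mu> UNIV))"
    unfolding bdry_mass1_def
  proof (rule SUP_least)
    fix \<phi> :: "real^'n \<Rightarrow> real"
    assume "\<phi> \<in> {\<phi>. test0 \<phi> \<and> (\<forall>x. \<bar>\<phi> x\<bar> \<le> 1)}"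
    then have c: "cc2 \<phi>" and b: "\<And>x. \<bar>\<phi> x\<bar> \<le> 1" by (auto intro: test0_cc2)
    then have "\<bar>\<Sum>i\<in>UNIV. T (means \<epsilon> ks (pd i \<phi>)) (\<lambda>x. x $ i)\<bar>
        \<le> CARD('n) * (2 * 1 / \<epsilon> * measure \<mu> UNIV)"
      using ks \<epsilon> by (intro sum_coordinates_bound[OF \<mu>] means_pd_bound cc1_lipb means_cc1)
        (auto simp: cc2_def)
    then show "ereal (?S (dfun \<phi>)) \<le> ereal (CARD('n) * (2 * 1 / \<epsilon> * measure \<mu> UNIV))"
      by (simp add: coord_functional_def dfun_def)
  qed
  have "mass1 ?S < \<infinity>" by (rule le_less_trans[OF m]) simp
  moreover have "bdry_mass1 ?S < \<infinity>" by (rule le_less_trans[OF bm]) simp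
  ultimately show ?thesis
    using coord_functional_current1[OF T \<Phi>] by (simp add: normal1_def)
qed

section \<open>Flat convergence\<close>

lemma dform_axis:
  fixes \<omega> :: "real^'n \<Rightarrow> real^'n"
  shows "dform \<omega> x (axis a 1) (axis b 1) = pd a (\<lambda>y. \<omega> y $ b) x - pd b (\<lambda>y. \<omega> y $ a) x"
proof -
  have "dform \<omega> x (axis a 1) (axis b 1) = (\<Sum>i\<in>UNIV. \<Sum>j\<in>UNIV.
      (if i = a then if j = b then pd i (\<lambda>y. \<omega> y $ j) x else 0 else 0) -
      (if i = b then if j = a then pd i (\<lambda>y. \<omega> y $ j) x else 0 else 0))"
    unfolding dform_def by (intro sum.cong refl) (auto simp: axis_def)
  also have "\<dots> = (\<Sum>i\<in>UNIV. if i = a then pd a (\<lambda>y. \<omega> y $ b) x else 0) -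
      (\<Sum>i\<in>UNIV. if i = b then pd b (\<lambda>y. \<omega> y $ a) x else 0)"
    unfolding sum_subtractf
    by (intro arg_cong2[where f = minus] sum.cong refl) (auto simp: sum.delta)
  finally show ?thesis by simp
qed

text \<open>A real \<open>Sup\<close> dominates its set only when the set is bounded above. Entries
  of unit vectors are at most 1 in absolute value, so each bracket in \<open>dform\<close> is at
  most 2.\<close>

lemma dform_le_comass2:
  fixes \<omega> :: "real^'n \<Rightarrow> real^'n"
  assumes "norm v = 1" "norm w = 1" "inner v w = 0"
  shows "dform \<omega> x v w \<le> comass2 (dform \<omega> x)"
  unfolding comass2_def
proof (rule cSup_upper)
  let ?B = "\<Sum>i\<in>UNIV. \<Sum>j\<in>UNIV. \<bar>pd i (\<lambda>y. \<omega> y $ j) x\<bar> * 2"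
  have "dform \<omega> x v w \<le> ?B" if vw: "norm v = 1" "norm w = 1" for v w
    unfolding dform_def
  proof (intro sum_mono)
    fix i j
    have v: "\<bar>v $ a\<bar> \<le> 1" and w: "\<bar>w $ a\<bar> \<le> 1" for a
      using component_le_norm_cart[of v a] component_le_norm_cart[of w a] vw by auto
    have "\<bar>v $ a\<bar> * \<bar>w $ b\<bar> \<le> 1 * 1" for a b
      by (intro mult_mono v w) auto
    from this[of i j] this[of j i] have "\<bar>v $ i * w $ j - v $ j * w $ i\<bar> \<le> 2"
      unfolding abs_mult[symmetric] by linarith
    then have "\<bar>pd i (\<lambda>y. \<omega> y $ j) x\<bar> * \<bar>v $ i * w $ j - v $ j * w $ i\<bar> \<le>
        \<bar>pd i (\<lambda>y. \<omega> y $ j) x\<bar> * 2"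
      by (intro mult_left_mono) auto
    then show "pd i (\<lambda>y. \<omega> y $ j) x * (v $ i * w $ j - v $ j * w $ i) \<le> \<bar>pd i (\<lambda>y. \<omega> y $ j) x\<bar> * 2"
      unfolding abs_mult[symmetric] by linarith
  qed
  moreover have "0 \<le> ?B" by (intro sum_nonneg) auto
  ultimately show "bdd_above (insert 0 {dform \<omega> x v w |v w. norm v = 1 \<and> norm w = 1 \<and> inner v w = 0})"
    unfolding bdd_above_def by blast
qed (use assms in blast)

text \<open>Testing the comass on the two orders of a pair of distinct axis vectors bounds the
  difference from both sides.\<close>

lemma comass2_le_imp_pd_diff:
  fixes \<omega> :: "real^'n \<Rightarrow> real^'n"
  assumes "comass2 (dform \<omega> x) \<le> 1"
  shows "\<bar>pd a (\<lambda>y. \<omega> y $ b) x - pd b (\<lambda>y. \<omega> y $ a) x\<bar> \<le> 1"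
proof (cases "a = b")
  case False
  then have o: "inner (axis a (1::real)) (axis b 1) = 0" "inner (axis b (1::real)) (axis a 1) = 0"
    by (auto simp: inner_axis_axis)
  show ?thesis
    using dform_le_comass2[of "axis a 1" "axis b 1" \<omega> x] dform_le_comass2[of "axis b 1" "axis a 1" \<omega> x]
      assms o by (simp add: dform_axis)
qed simp

definition flat_unit_ball :: "(real^'n \<Rightarrow> real^'n) set" where
  "flat_unit_ball = {\<omega>. test1 \<omega> \<and> (\<forall>x. norm (\<omega> x) \<le> 1) \<and> (\<forall>x. comass2 (dform \<omega> x) \<le> 1)}"

text \<open>Serves to choose worst forms from a nonempty set and to see that the flat norms below
  are nonnegative.\<close>

lemma zero_flat_unit_ball: "(\<lambda>x. 0) \<in> (flat_unit_ball :: (real^'n \<Rightarrow> real^'n) set)"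
proof -
  have p: "pd i (\<lambda>x::real^'n. 0) = (\<lambda>x. 0)" for i by (auto simp: pd_def)
  have "pdl \<alpha> (\<lambda>x::real^'n. 0) = (\<lambda>x. 0)" for \<alpha> by (induction \<alpha>) (simp_all add: p)
  then have "test1 (\<lambda>x. 0 :: real^'n)"
    by (simp add: test1_def test0_def smooth_fun_def)
  have "dform (\<lambda>x. 0 :: real^'n) x v w = 0" for x v w by (simp add: dform_def p)
  then have "comass2 (dform (\<lambda>x. 0 :: real^'n) x) = Sup {0::real}" for x
    unfolding comass2_def by (intro arg_cong[where f = Sup]) auto
  then show ?thesis using \<open>test1 (\<lambda>x. 0 :: real^'n)\<close> by (simp add: flat_unit_ball_def)
qed

text \<open>The forms vary with \<open>k\<close> because the continuity axiom concerns sequences and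
  gives no rate; uniformity over the unit ball is extracted afterwards.\<close>

lemma means_sequence_tendsto:
  fixes T :: "(real^'n \<Rightarrow> real) \<Rightarrow> (real^'n \<Rightarrow> real) \<Rightarrow> real"
  assumes T: "metric_current1 T" and \<epsilon>: "\<And>k. 0 < \<epsilon> k" "\<And>k. \<epsilon> k \<le> 1" "\<epsilon> \<longlonglongrightarrow> 0"
    and \<omega>: "\<And>k. \<omega> k \<in> flat_unit_ball"
  shows "(\<lambda>k. coord_functional T (means (\<epsilon> k) ks) (\<omega> k) - coord_functional T (\<lambda>g. g) (\<omega> k)) \<longlonglongrightarrow> 0"
proof -
  obtain \<mu> where \<mu>: "mass_bound T \<mu>" using metric_current1_mass_bound[OF T] by blast
  have c2: "cc2 (\<lambda>x. \<omega> k x $ j)" for k j using \<omega> by (auto simp: flat_unit_ball_def test1_cc2)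
  then have c1: "cc1 (\<lambda>x. \<omega> k x $ j)" for k j by (simp add: cc2_def)
  have nb: "norm (\<omega> k x) \<le> 1" for k x using \<omega>[of k] by (simp add: flat_unit_ball_def)
  have b: "\<bar>\<omega> k x $ j\<bar> \<le> 1" for k j x
    using component_le_norm_cart[of "\<omega> k x" j] nb[of k x] by linarith
  have d: "\<bar>pd i (\<lambda>y. \<omega> k y $ j) x - pd j (\<lambda>y. \<omega> k y $ i) x\<bar> \<le> 1" for i j k x
    using \<omega>[of k] by (intro comass2_le_imp_pd_diff) (simp add: flat_unit_ball_def)
  define l where "l = real (length ks)"
  have "\<forall>k. \<exists>f \<theta>. cc2 f \<and> (\<forall>j. cc1 (\<theta> j)) \<and> (\<forall>x. \<bar>f x\<bar> \<le> l * \<epsilon> k) \<and>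
    (\<forall>j x. \<bar>\<theta> j x\<bar> \<le> l * \<epsilon> k) \<and>
    (\<forall>j x. means (\<epsilon> k) ks (\<lambda>y. \<omega> k y $ j) x - \<omega> k x $ j = pd j f x + \<theta> j x)"
    unfolding l_def using means_homotopy[OF \<epsilon>(1) c2 b d] by blast
  then obtain f \<theta> where f: "\<And>k. cc2 (f k)" "\<And>k x. \<bar>f k x\<bar> \<le> l * \<epsilon> k"
    and \<theta>: "\<And>k j. cc1 (\<theta> k j)" "\<And>k j x. \<bar>\<theta> k j x\<bar> \<le> l * \<epsilon> k"
    and eq: "\<And>k j x. means (\<epsilon> k) ks (\<lambda>y. \<omega> k y $ j) x - \<omega> k x $ j = pd j (f k) x + \<theta> k j x"
    by metis
  have l\<epsilon>: "l * \<epsilon> k \<le> l" for k using \<epsilon>(2)[of k] by (simp add: l_def mult_left_le)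
  have mb: "\<bar>means (\<epsilon> k) ks (\<lambda>y. \<omega> k y $ j) x\<bar> \<le> 1" for k j x
    by (rule means_bound[OF \<epsilon>(1) c1 b])
  \<comment> \<open>The averaged and the original coefficient contribute 1 each, the remainder
    \<open>l\<close>. The resulting Lipschitz constant is independent of \<open>k\<close>, as the
    continuity axiom requires.\<close>
  have "\<bar>pd j (f k) x\<bar> \<le> 2 + l" for k j x
    using eq[of k j x] \<theta>(2)[of k j x] mb[of k j x] b[of k x j] l\<epsilon>[of k] by linarith
  then have lip: "((2 + l) * CARD('n))-lipschitz_on UNIV (f k)" for k
    using f(1) by (intro lipschitz_of_pd_bound) (auto simp: cc2_def cc1_def l_def)
  have l0: "(\<lambda>k. l * \<epsilon> k) \<longlonglongrightarrow> 0" using tendsto_mult_right_zero[OF \<epsilon>(3)] .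
  have "(\<lambda>k. T (\<lambda>x. 1) (f k)) \<longlonglongrightarrow> T (\<lambda>x. 1) (\<lambda>x. 0)"
  proof (rule metric_current1_continuous[OF T lipb_const lip])
    show "(\<lambda>k. f k x) \<longlonglongrightarrow> 0" for x
      by (rule tendsto_rabs_zero_cancel, rule tendsto_sandwich[OF _ _ tendsto_const l0]) (auto simp: f(2))
  qed
  then have 1: "(\<lambda>k. T (\<lambda>x. 1) (f k)) \<longlonglongrightarrow> 0"
    by (simp add: metric_current1_zero2[OF T lipb_const])
  have 2: "(\<lambda>k. \<Sum>j\<in>UNIV. T (\<theta> k j) (\<lambda>x. x $ j)) \<longlonglongrightarrow> 0"
  proof (rule tendsto_rabs_zero_cancel, rule tendsto_sandwich[OF _ _ tendsto_const])
    show "(\<lambda>k. CARD('n) * (l * \<epsilon> k * measure \<mu> UNIV)) \<longlonglongrightarrow> 0"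
      by (intro tendsto_mult_right_zero tendsto_mult_left_zero l0 \<epsilon>(3))
    show "\<forall>\<^sub>F k in sequentially. \<bar>\<Sum>j\<in>UNIV. T (\<theta> k j) (\<lambda>x. x $ j)\<bar>
        \<le> CARD('n) * (l * \<epsilon> k * measure \<mu> UNIV)"
      by (intro always_eventually allI sum_coordinates_bound[OF \<mu>] cc1_lipb \<theta>)
  qed auto
  have "coord_functional T (means (\<epsilon> k) ks) (\<omega> k) - coord_functional T (\<lambda>g. g) (\<omega> k) =
      T (\<lambda>x. 1) (f k) + (\<Sum>j\<in>UNIV. T (\<theta> k j) (\<lambda>x. x $ j))" for k
  proof -
    have pf: "cc1 (pd j (f k))" for j using f(1) by (simp add: cc2_def)
    have "T (means (\<epsilon> k) ks (\<lambda>x. \<omega> k x $ j)) (\<lambda>x. x $ j) - T (\<lambda>x. \<omega> k x $ j) (\<lambda>x. x $ j) =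
        T (pd j (f k)) (\<lambda>x. x $ j) + T (\<theta> k j) (\<lambda>x. x $ j)" for j
    proof -
      have "T (\<lambda>x. 1 * means (\<epsilon> k) ks (\<lambda>x. \<omega> k x $ j) x + (-1) * \<omega> k x $ j) (\<lambda>x. x $ j) =
          T (\<lambda>x. 1 * pd j (f k) x + 1 * \<theta> k j x) (\<lambda>x. x $ j)"
        using eq[of k j] by simp
      then show ?thesis
        by (simp only: metric_current1_linear1[OF T _ _ lipf_coordinate] cc1_lipb pf \<theta> c1 means_cc1)
    qed
    then show ?thesis
      by (simp add: coord_functional_def sum_subtractf[symmetric] sum.distrib
          metric_current1_chain_rule[OF T f(1)])
  qed
  then show ?thesis using tendsto_add[OF 1 2] by simp
qed

text \<open>For each \<open>k\<close> a form violating the bound is chosen whenever one exists.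
  Convergence along the chosen sequence rules out violations for all large \<open>k\<close>.\<close>

lemma means_uniformly_small:
  fixes T :: "(real^'n \<Rightarrow> real) \<Rightarrow> (real^'n \<Rightarrow> real) \<Rightarrow> real"
  assumes T: "metric_current1 T" and \<epsilon>: "\<And>k. 0 < \<epsilon> k" "\<And>k. \<epsilon> k \<le> 1" "\<epsilon> \<longlonglongrightarrow> 0"
    and \<delta>: "0 < \<delta>"
  shows "\<forall>\<^sub>F k in sequentially. \<forall>\<omega>\<in>flat_unit_ball.
    \<bar>coord_functional T (means (\<epsilon> k) ks) \<omega> - coord_functional T (\<lambda>g. g) \<omega>\<bar> < \<delta>"
proof -
  let ?E = "\<lambda>k \<omega>. \<bar>coord_functional T (means (\<epsilon> k) ks) \<omega> - coord_functional T (\<lambda>g. g) \<omega>\<bar>"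
  have "\<forall>k. \<exists>\<omega>\<in>flat_unit_ball. (\<exists>\<eta>\<in>flat_unit_ball. \<not> ?E k \<eta> < \<delta>) \<longrightarrow> \<not> ?E k \<omega> < \<delta>"
    using zero_flat_unit_ball by blast
  then obtain \<omega> where \<omega>: "\<And>k. \<omega> k \<in> flat_unit_ball"
    "\<And>k. (\<exists>\<eta>\<in>flat_unit_ball. \<not> ?E k \<eta> < \<delta>) \<Longrightarrow> \<not> ?E k (\<omega> k) < \<delta>"
    by metis
  have "\<forall>\<^sub>F k in sequentially. ?E k (\<omega> k) < \<delta>"
    using tendstoD[OF means_sequence_tendsto[OF T \<epsilon> \<omega>(1)] \<delta>] by (simp add: dist_real_def)
  then show ?thesis
    by eventually_elim (use \<omega>(2) in blast)
qed

theorem mainTheorem1: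
  fixes T :: "(real^'n \<Rightarrow> real) \<Rightarrow> (real^'n \<Rightarrow> real) \<Rightarrow> real"
  assumes "metric_current1 T"
  shows "flat_chain1 (induced1 T)"
proof -
  note T = assms
  have ind: "induced1 T = coord_functional T (\<lambda>g. g)"
    by (simp add: fun_eq_iff induced1_def coord_functional_def)
  obtain ks :: "'n list" where ks: "set ks = UNIV" using finite_list[of "UNIV :: 'n set"] by auto
  define \<epsilon> where "\<epsilon> k = 1 / real (Suc k)" for k
  have \<epsilon>: "\<And>k. 0 < \<epsilon> k" "\<And>k. \<epsilon> k \<le> 1" "\<epsilon> \<longlonglongrightarrow> 0"
    using LIMSEQ_inverse_real_of_nat by (auto simp: \<epsilon>_def[abs_def] field_simps)
  define N where "N k = coord_functional T (means (\<epsilon> k) ks)" for k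
  have N: "normal1 (N k)" for k unfolding N_def by (rule means_normal1[OF T \<epsilon>(1) ks])
  have fn: "flat_norm1 S = (SUP \<omega>\<in>flat_unit_ball. ereal (S \<omega>))" for S :: "(real^'n \<Rightarrow> real^'n) \<Rightarrow> real"
    by (simp add: flat_norm1_def flat_unit_ball_def)
  let ?F = "\<lambda>k. flat_norm1 (\<lambda>\<omega>. induced1 T \<omega> - N k \<omega>)"
  have zero: "coord_functional T \<Phi> (\<lambda>x. 0) = 0" if "contraction_op \<Phi>" for \<Phi>
  proof -
    have "cc1 (\<lambda>x::real^'n. 0)" using zero_cc2 unfolding cc2_def by blast
    then show ?thesis
      using coord_functional_linear[OF T that, of "\<lambda>x. 0" "\<lambda>x. 0" 0 0] by simp
  qed
  \<comment> \<open>The zero form contributes the value 0 to the supremum, so only upper bounds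
    remain to be shown.\<close>
  have "0 \<le> ?F k" for k
    unfolding fn using zero_flat_unit_ball
    by (rule SUP_upper2) (simp add: ind N_def zero contraction_op_id contraction_op_means \<epsilon>)
  moreover have "\<forall>\<^sub>F k in sequentially. ?F k \<le> ereal \<delta>" if "0 < \<delta>" for \<delta>
    using means_uniformly_small[OF T \<epsilon> that, of ks]
  proof eventually_elim
    case (elim k)
    show ?case unfolding fn
      by (rule SUP_least) (use elim in \<open>fastforce simp: ind N_def abs_less_iff\<close>)
  qed
  ultimately have "?F \<longlonglongrightarrow> 0"
  proof (intro order_tendstoI)
    fix a :: ereal assume "\<And>k. 0 \<le> ?F k" "a < 0"
    then show "\<forall>\<^sub>F k in sequentially. a < ?F k" by (meson always_eventually less_le_trans)
  next
    fix a :: ereal assume F: "\<And>\<delta>. 0 < \<delta> \<Longrightarrow> \<forall>\<^sub>F k in sequentially. ?F k \<le> ereal \<delta>" and "0 < a"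
    \<comment> \<open>Since \<open>a\<close> may be infinite, a real number strictly between 0 and
      \<open>a\<close> is inserted; it also makes up for the non-strict bound on the
      supremum.\<close>
    then obtain \<delta> where "0 < ereal \<delta>" "ereal \<delta> < a" using ereal_dense2 by blast
    then show "\<forall>\<^sub>F k in sequentially. ?F k < a"
      using F[of \<delta>] by (auto elim: eventually_mono)
  qed
  then show ?thesis
    using N coord_functional_current1[OF T contraction_op_id] unfolding flat_chain1_def ind by blast
qed

end
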